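(* Let $2\le k\le n-1$, let $H:(-\varepsilon_0,\varepsilon_0)\to\mathrm{Herm}(n)$ be real-analytic with $H(0)\in\Sigma_k$, and let $\lambda_1(t)\le\dots\le\lambda_n(t)$ be the eigenvalues of $H(t)$, $\bar\lambda(t)=\frac1k\sum_{j=1}^k\lambda_j(t)$. Then there is $\varepsilon>0$ such that each of the functions $\mathfrak s_k(t)=D_k(H(t))$, $\mathfrak s_{i,j}(t)=\lambda_i(t)-\lambda_j(t)$ ($1\le i<j\le k$) and $\overline{\mathfrak s}_i(t)=\lambda_i(t)-\bar\lambda(t)$ ($1\le i\le k$) coincides on $[0,\varepsilon)$ with a convergent power series in $t$, and $$\mathrm{ord}_0(\mathfrak s_k)=\min_{1\le i<j\le k}\mathrm{ord}_0(\mathfrak s_{i,j})=\min_{1\le i\le k-1}\mathrm{ord}_0(\mathfrak s_{i,i+1})=\mathrm{ord}_0(\mathfrak s_{1,k})=\min_{1\le i\le k}\mathrm{ord}_0(\overline{\mathfrak s}_i).$$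
   Context: $\mathrm{Herm}(n)$: $n\times n$ complex Hermitian matrices; eigenvalues $\lambda_1(H)\le\dots\le\lambda_n(H)$. For $2\le k\le n-1$, $\Sigma_k=\{H:\lambda_1=\dots=\lambda_k<\lambda_{k+1}\}$. $D_k(H)=\sqrt{\frac1k\sum_{j=1}^k(\lambda_j(H)-\bar\lambda)^2}$ with $\bar\lambda=\frac1k\sum_{j=1}^k\lambda_j(H)$. For a function $g$ which on $[0,\varepsilon)$ coincides with a convergent power series $\sum_{m\ge0}a_mt^m$, $\mathrm{ord}_0(g)=\min\{m:a_m\ne0\}$, and $\mathrm{ord}_0(g)=\infty$ if all $a_m=0$. *)

theory Defs
  imports "HOL-Analysis.Analysis" "HOL-Library.Extended_Nat" "HOL-Library.Multiset"
    "Jordan_Normal_Form.Char_Poly"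
begin

definition herm :: "nat \<Rightarrow> complex mat set" where
  "herm n = {A. A \<in> carrier_mat n n \<and> (\<forall>i<n. \<forall>j<n. A $$ (i,j) = cnj (A $$ (j,i)))}"

(* eigenvalues counted with algebraic multiplicity (roots of the characteristic
   polynomial), real parts taken (they are real for Hermitian A), in increasing order *)
definition eigs :: "complex mat \<Rightarrow> real list" where
  "eigs A = sorted_list_of_multiset (image_mset Re (proots (char_poly A)))"

definition lam :: "complex mat \<Rightarrow> nat \<Rightarrow> real" where
  "lam A j = eigs A ! (j - 1)"

definition Sigma :: "nat \<Rightarrow> nat \<Rightarrow> complex mat set" where
  "Sigma n k = {H \<in> herm n. (\<forall>j. 1 \<le> j \<and> j \<le> k \<longrightarrow> lam H j = lam H 1) \<and> lam H k < lam H (k+1)}"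

definition lam_mean :: "nat \<Rightarrow> complex mat \<Rightarrow> real" where
  "lam_mean k H = (\<Sum>j=1..k. lam H j) / real k"

definition D :: "nat \<Rightarrow> complex mat \<Rightarrow> real" where
  "D k H = sqrt ((\<Sum>j=1..k. (lam H j - lam_mean k H)^2) / real k)"

definition real_analytic_on :: "(real \<Rightarrow> complex) \<Rightarrow> real set \<Rightarrow> bool" where
  "real_analytic_on f S \<longleftrightarrow> (\<forall>x\<in>S. \<exists>r>0. \<exists>a :: nat \<Rightarrow> complex.
      \<forall>y. \<bar>y - x\<bar> < r \<longrightarrow> (\<lambda>m. a m * complex_of_real ((y - x)^m)) sums f y)"

definition ps_on :: "(real \<Rightarrow> real) \<Rightarrow> real \<Rightarrow> (nat \<Rightarrow> real) \<Rightarrow> bool" where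
  "ps_on g eps a \<longleftrightarrow> (\<forall>t\<in>{0..<eps}. (\<lambda>m. a m * t^m) sums g t)"

definition ord0 :: "(real \<Rightarrow> real) \<Rightarrow> enat" where
  "ord0 g = (let a = (SOME a. \<exists>eps>0. ps_on g eps a) in
     if (\<forall>m. a m = 0) then \<infinity> else enat (LEAST m. a m \<noteq> 0))"

end

(* Sorting the eigenvalues destroys two-sided analyticity, but it does no more than permute, on each
   side of 0, a family of analytic functions (Rellich). Only the power sums of the eigenvalues,
   i.e. the traces of H(t)^j, are known to be analytic, and real-rootedness does the rest: after
   subtracting the mean, the sum of squares of the roots is t^(2m) g(t) with g(0) > 0, so that
   all roots are O(t^m) and can be divided by t^m. The rescaled roots no longer all coincide at
   t = 0, the power sums of a cluster of them are contour integrals and hence analytic, and one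
   inducts on the number of roots.
   Given analyticity on [0, eps), ord_0 g >= m means g(t) = O(t^m) as t tends to 0+, and the
   equalities of orders reduce to elementary inequalities between D_k, the gaps and the deviations. *)
theory Submission
  imports Defs "HOL-Complex_Analysis.Complex_Analysis" "Jordan_Normal_Form.Schur_Decomposition"
begin

section \<open>Germs of analytic functions\<close>

text \<open>The induction speaks of a family of multisets \<open>M t\<close> whose power sums are
  germs, because this hypothesis survives every operation involved: subtracting the mean, dividing
  by a power of t, and cutting out a cluster. Newton's identities lead from power sums to
  coefficients, where a contour can be drawn around some roots, and the contour integrals lead back
  to power sums. Real-rootedness enters through the sum of squares of the centred roots: it
  dominates every root, and being nonnegative on both sides of 0 it has even order 2m, so that no
  branch t^(1/2) can occur. This is why germs are two-sided although the theorem looks only at t >=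
  0. A germ forgets the value at 0, but \<open>ps_on\<close> includes t = 0. That value is recovered
  at the end: the limits of the ordered branches form a sorted list with the same power sums as the
  spectrum of \<open>H 0\<close>, hence they are that spectrum. Two orders are shown equal by
  comparing which finite m lie below them, so no coefficient is computed and identically vanishing
  functions require no separate case.\<close>

text \<open>The value at 0 is deliberately ignored, so that dividing by a power of \<open>t\<close> needs no
  case distinction.\<close>

definition cgerm :: "(real \<Rightarrow> complex) \<Rightarrow> bool" where
  "cgerm f \<longleftrightarrow> (\<exists>F. F analytic_on {0} \<and> (\<forall>\<^sub>F t in at 0. f t = F (complex_of_real t)))"

abbreviation rgerm :: "(real \<Rightarrow> real) \<Rightarrow> bool" where
  "rgerm f \<equiv> cgerm (\<lambda>t. complex_of_real (f t))"

lemma filterlim_of_real_at_0: "filterlim complex_of_real (at 0) (at 0)"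
  unfolding filterlim_at by (auto intro!: tendsto_eq_intros simp: eventually_at_filter)

lemma eventually_neq_0: "\<forall>\<^sub>F t in at (0::real). t \<noteq> 0"
  by (simp add: eventually_at_filter)

lemma eventually_at_0_of_real:
  "eventually P (at (0::complex)) \<Longrightarrow> \<forall>\<^sub>F t in at (0::real). P (complex_of_real t)"
  using filterlim_of_real_at_0 by (simp add: filterlim_iff)

lemma cgermI:
  "F analytic_on {0} \<Longrightarrow> \<forall>\<^sub>F t in at 0. f t = F (complex_of_real t) \<Longrightarrow> cgerm f"
  unfolding cgerm_def by blast

lemma cgerm_cong:
  assumes "cgerm f" "\<forall>\<^sub>F t in at 0. f t = g t"
  shows "cgerm g"
proof -
  obtain F where F: "F analytic_on {0}" "\<forall>\<^sub>F t in at 0. f t = F (complex_of_real t)"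
    using assms(1) unfolding cgerm_def by blast
  from F(2) assms(2) have "\<forall>\<^sub>F t in at 0. g t = F (complex_of_real t)"
    by eventually_elim simp
  with F(1) show ?thesis by (rule cgermI)
qed

lemma cgerm_const [simp, intro]: "cgerm (\<lambda>t. c)"
  by (rule cgermI[of "\<lambda>z. c"]) auto

lemma cgerm_ident [simp, intro]: "cgerm complex_of_real"
  by (rule cgermI[of "\<lambda>z. z"]) auto

lemma cgerm_add [intro]:
  assumes "cgerm f" "cgerm g" shows "cgerm (\<lambda>t. f t + g t)"
proof -
  obtain F G where "F analytic_on {0}" "\<forall>\<^sub>F t in at 0. f t = F (complex_of_real t)"
    "G analytic_on {0}" "\<forall>\<^sub>F t in at 0. g t = G (complex_of_real t)"
    using assms unfolding cgerm_def by blast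
  then show ?thesis
    by (intro cgermI[of "\<lambda>z. F z + G z"] analytic_on_add) (auto elim: eventually_elim2)
qed

lemma cgerm_mult [intro]:
  assumes "cgerm f" "cgerm g" shows "cgerm (\<lambda>t. f t * g t)"
proof -
  obtain F G where "F analytic_on {0}" "\<forall>\<^sub>F t in at 0. f t = F (complex_of_real t)"
    "G analytic_on {0}" "\<forall>\<^sub>F t in at 0. g t = G (complex_of_real t)"
    using assms unfolding cgerm_def by blast
  then show ?thesis
    by (intro cgermI[of "\<lambda>z. F z * G z"] analytic_on_mult) (auto elim: eventually_elim2)
qed

lemma cgerm_minus [intro]: "cgerm f \<Longrightarrow> cgerm (\<lambda>t. - f t)"
  using cgerm_mult[OF cgerm_const[of "-1"], of f] by simp

lemma cgerm_diff [intro]: "cgerm f \<Longrightarrow> cgerm g \<Longrightarrow> cgerm (\<lambda>t. f t - g t)"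
  using cgerm_add[OF _ cgerm_minus, of f g] by simp

lemma cgerm_power [intro]: "cgerm f \<Longrightarrow> cgerm (\<lambda>t. f t ^ m)"
  by (induction m) auto

lemma cgerm_sum [intro]: "(\<And>i. i \<in> I \<Longrightarrow> cgerm (f i)) \<Longrightarrow> cgerm (\<lambda>t. \<Sum>i\<in>I. f i t)"
  by (induction I rule: infinite_finite_induct) auto

lemma cgerm_divide_const [intro]: "cgerm f \<Longrightarrow> cgerm (\<lambda>t. f t / c)"
  using cgerm_mult[of f "\<lambda>t. 1 / c"] by simp

section \<open>Limits, leading terms, division and square roots of germs\<close>

lemma analytic_at_0_tendsto:
  assumes "F analytic_on {0}"
  shows "((\<lambda>t. F (complex_of_real t)) \<longlongrightarrow> F 0) (at 0)"
proof -
  have "isCont F 0" using assms by (rule analytic_at_imp_isCont)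
  then have "(F \<longlongrightarrow> F 0) (at 0)" by (simp add: isCont_def)
  then show ?thesis using filterlim_of_real_at_0 by (rule filterlim_compose)
qed

lemma rgerm_tendsto:
  assumes "F analytic_on {0}" "\<forall>\<^sub>F t in at 0. complex_of_real (f t) = F (complex_of_real t)"
  shows "(f \<longlongrightarrow> Re (F 0)) (at 0)" "F 0 = of_real (Re (F 0))"
proof -
  have lim: "((\<lambda>t. complex_of_real (f t)) \<longlongrightarrow> F 0) (at 0)"
    using analytic_at_0_tendsto[OF assms(1)]
    by (rule Lim_transform_eventually) (use assms(2) in eventually_elim, simp)
  from tendsto_Re[OF lim] show "(f \<longlongrightarrow> Re (F 0)) (at 0)" by simp
  have "((\<lambda>t. 0) \<longlongrightarrow> Im (F 0)) (at (0::real))" using tendsto_Im[OF lim] by simp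
  then have "Im (F 0) = 0" by (simp add: tendsto_const_iff)
  then show "F 0 = of_real (Re (F 0))" by (simp add: complex_eq_iff)
qed

lemma rgerm_has_limit:
  assumes "rgerm f" obtains L where "(f \<longlongrightarrow> L) (at 0)"
  using assms rgerm_tendsto(1) unfolding cgerm_def by blast

text \<open>Isolation of zeros: a holomorphic extension vanishes near 0 or is a power of z times a
  function nonzero at 0. The cofactor is taken to be \<open>f t / t ^ m\<close> itself, which keeps
  it real-valued.\<close>

lemma rgerm_factor:
  assumes "rgerm f"
  shows "(\<forall>\<^sub>F t in at 0. f t = 0) \<or>
    (\<exists>m g L. rgerm g \<and> L \<noteq> 0 \<and> (g \<longlongrightarrow> L) (at 0) \<and> (\<forall>\<^sub>F t in at 0. f t = t ^ m * g t))"
proof -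
  obtain F where F: "F analytic_on {0}" "\<forall>\<^sub>F t in at 0. complex_of_real (f t) = F (complex_of_real t)"
    using assms unfolding cgerm_def by blast
  obtain r where r: "r > 0" "F holomorphic_on ball 0 r"
    using F(1) unfolding analytic_at_ball by blast
  have zero: ?thesis if "\<forall>z\<in>ball 0 r. F z = 0"
  proof -
    have "\<forall>\<^sub>F z in at (0::complex). z \<in> ball 0 r"
      by (rule eventually_at_in_open') (use r in auto)
    from eventually_at_0_of_real[OF this] F(2) have "\<forall>\<^sub>F t in at 0. f t = 0"
      by eventually_elim (use that in auto)
    then show ?thesis ..
  qed
  have fact: "(\<forall>z\<in>ball 0 r. F z = 0) \<or> (\<exists>G n s. s > 0 \<and> G holomorphic_on ball 0 s \<and> G 0 \<noteq> 0 \<and>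
      (\<forall>z\<in>ball 0 s. F z = z ^ n * G z))"
  proof (cases "F 0 = 0")
    case False
    then show ?thesis using r by (intro disjI2 exI[of _ F] exI[of _ 0] exI[of _ r]) auto
  next
    case True
    show ?thesis
    proof (cases "F constant_on ball 0 r")
      case c: True
      then have "\<forall>z\<in>ball 0 r. F z = 0" using True r(1) unfolding constant_on_def
        by (metis centre_in_ball)
      then show ?thesis ..
    next
      case False
      obtain G s n where "0 < (n::nat)" "0 < s" "ball 0 s \<subseteq> ball (0::complex) r"
        "G holomorphic_on ball 0 s" "\<And>w. w \<in> ball 0 s \<Longrightarrow> F w = (w - 0) ^ n * G w"
        "\<And>w. w \<in> ball 0 s \<Longrightarrow> G w \<noteq> 0"
        using holomorphic_factor_zero_nonconstant[OF r(2) open_ball connected_ball _ True False] r(1)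
        by (metis centre_in_ball)
      then show ?thesis by (intro disjI2 exI[of _ G] exI[of _ n] exI[of _ s]) auto
    qed
  qed
  show ?thesis
  proof (cases "\<forall>z\<in>ball 0 r. F z = 0")
    case True
    then show ?thesis by (rule zero)
  next
    case False
    then obtain G n s where G: "s > 0" "G holomorphic_on ball 0 s" "G 0 \<noteq> 0"
      "\<forall>z\<in>ball 0 s. F z = z ^ n * G z" using fact by blast
    have an: "G analytic_on {0}" using G analytic_at_ball by blast
    have "\<forall>\<^sub>F z in at (0::complex). z \<in> ball 0 s"
      by (rule eventually_at_in_open') (use G in auto)
    from eventually_at_0_of_real[OF this] F(2) eventually_neq_0
    have ev: "\<forall>\<^sub>F t in at 0. complex_of_real (f t / t ^ n) = G (complex_of_real t)"
      by eventually_elim (use G in auto)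
    have "rgerm (\<lambda>t. f t / t ^ n)" using an ev by (rule cgermI)
    \<comment> \<open>\<open>G 0\<close> is a limit of real numbers, hence real, so its real part is
      nonzero as well.\<close>
    moreover have "((\<lambda>t. f t / t ^ n) \<longlongrightarrow> Re (G 0)) (at 0)" "Re (G 0) \<noteq> 0"
      using rgerm_tendsto[OF an ev] G(3) by auto
    moreover have "\<forall>\<^sub>F t in at 0. f t = t ^ n * (f t / t ^ n)"
      using eventually_neq_0 by eventually_elim simp
    ultimately show ?thesis
      by (intro disjI2 exI[of _ n] exI[of _ "\<lambda>t. f t / t ^ n"] exI[of _ "Re (G 0)"] conjI)
  qed
qed

lemma eventually_at_0_uminus:
  "eventually P (at (0::real)) \<Longrightarrow> \<forall>\<^sub>F t in at 0. P (- t)"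
  by (subst (asm) filtermap_at_minus[of 0, simplified, symmetric]) (simp add: eventually_filtermap)

text \<open>With an odd exponent \<open>f\<close> would change sign at 0; this uses the hypothesis
  on both sides of 0.\<close>

lemma rgerm_factor_nonneg:
  assumes "rgerm f" "\<forall>\<^sub>F t in at 0. f t \<ge> 0"
  shows "(\<forall>\<^sub>F t in at 0. f t = 0) \<or>
    (\<exists>m g L. rgerm g \<and> L > 0 \<and> (g \<longlongrightarrow> L) (at 0) \<and> (\<forall>\<^sub>F t in at 0. f t = (t ^ m)\<^sup>2 * g t))"
proof (rule disjCI)
  assume "\<not> (\<exists>m g L. rgerm g \<and> L > 0 \<and> (g \<longlongrightarrow> L) (at 0) \<and> (\<forall>\<^sub>F t in at 0. f t = (t ^ m)\<^sup>2 * g t))"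
  note no = this
  show "\<forall>\<^sub>F t in at 0. f t = 0"
  proof (rule ccontr)
    assume "\<not> ?thesis"
    then obtain m g L where g: "rgerm g" "L \<noteq> 0" "(g \<longlongrightarrow> L) (at 0)"
      "\<forall>\<^sub>F t in at 0. f t = t ^ m * g t" using rgerm_factor[OF assms(1)] by blast
    \<comment> \<open>Multiplying by \<open>L\<close> handles both possible signs of the limit at
      once.\<close>
    have sgn: "\<forall>\<^sub>F t in at 0. g t * L > 0"
    proof (rule order_tendstoD)
      show "((\<lambda>t. g t * L) \<longlongrightarrow> L * L) (at 0)" by (intro tendsto_intros g)
      show "0 < L * L" using g(2) by (simp add: zero_less_mult_iff) linarith
    qed
    have pos: "\<forall>\<^sub>F t in at 0. t ^ m * L > 0"
      using sgn g(4) assms(2) eventually_neq_0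
    proof eventually_elim
      case (elim t)
      have "0 \<le> t ^ m * g t * L\<^sup>2" using elim by simp
      then have "0 \<le> (t ^ m * L) * (g t * L)" by (simp add: power2_eq_square mult_ac)
      then have "0 \<le> t ^ m * L" using elim(1) by (simp add: zero_le_mult_iff)
      moreover have "t ^ m * L \<noteq> 0" using elim g(2) by simp
      ultimately show ?case by linarith
    qed
    \<comment> \<open>The inequality is used at t and at -t; for odd m the two values would be
      opposite.\<close>
    from pos eventually_at_0_uminus[OF pos] have "\<forall>\<^sub>F t in at (0::real). even m \<and> L > 0"
    proof eventually_elim
      case (elim t)
      have ev: "even m"
      proof (rule ccontr)
        assume "odd m"
        then have "(- t) ^ m * L = - (t ^ m * L)" by simp
        then show False using elim by linarith
      qed
      then have "L > 0" using elim(1) by (auto simp: zero_less_mult_iff)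
      then show ?case using ev by simp
    qed
    then have m: "even m" "L > 0" by auto
    then obtain l where "m = l * 2" by (elim evenE) auto
    then have "\<forall>\<^sub>F t in at 0. f t = (t ^ l)\<^sup>2 * g t" using g(4) by (simp add: power_mult)
    then show False using no g(1,3) m(2) by blast
  qed
qed

text \<open>A bounded quotient has no pole: if \<open>f\<close> had order m < N, then |g t| <= C
  |t|^(N - m) would force the nonzero limit of the cofactor \<open>g\<close> to be 0.\<close>

lemma rgerm_divide_power:
  assumes "rgerm f" "\<forall>\<^sub>F t in at 0. \<bar>f t / t ^ N\<bar> \<le> C"
  shows "rgerm (\<lambda>t. f t / t ^ N)"
proof (cases "\<forall>\<^sub>F t in at 0. f t = 0")
  case True
  show ?thesis
    by (rule cgerm_cong[OF cgerm_const[of 0]]) (use True in eventually_elim, simp)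
next
  case False
  then obtain m g L where g: "rgerm g" "L \<noteq> 0" "(g \<longlongrightarrow> L) (at 0)"
    "\<forall>\<^sub>F t in at 0. f t = t ^ m * g t" using rgerm_factor[OF assms(1)] by blast
  have "N \<le> m"
  proof (rule ccontr)
    assume "\<not> N \<le> m"
    then obtain d where d: "N = m + Suc d" by (metis add_Suc_right less_imp_Suc_add not_le)
    have "\<forall>\<^sub>F t in at 0. \<bar>g t\<bar> \<le> C * \<bar>t\<bar> ^ Suc d"
      using assms(2) g(4) eventually_neq_0
    proof eventually_elim
      case (elim t)
      have "f t / t ^ N = g t / t ^ Suc d" using elim by (simp add: d power_add)
      then have "\<bar>g t\<bar> / \<bar>t\<bar> ^ Suc d \<le> C" using elim by (simp add: abs_divide abs_mult power_abs)
      then show ?case using elim(3) by (simp add: divide_le_eq)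
    qed
    moreover have "((\<lambda>t. C * \<bar>t\<bar> ^ Suc d) \<longlongrightarrow> 0) (at (0::real))"
      by (auto intro!: tendsto_eq_intros)
    moreover have "((\<lambda>t. \<bar>g t\<bar>) \<longlongrightarrow> \<bar>L\<bar>) (at 0)" by (intro tendsto_intros g)
    ultimately have "\<bar>L\<bar> \<le> 0" by (intro tendsto_le[of "at (0::real)"]) auto
    then show False using g(2) by simp
  qed
  then obtain d where d: "m = N + d" using le_Suc_ex by blast
  have "rgerm (\<lambda>t. t ^ d * g t)"
    unfolding of_real_mult of_real_power by (intro cgerm_mult cgerm_power cgerm_ident g)
  then show ?thesis
    by (rule cgerm_cong) (use g(4) eventually_neq_0 in eventually_elim, simp add: d power_add)
qed

text \<open>\<open>csqrt\<close> is analytic away from the nonpositive real axis, and the extension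
  takes the value \<open>L\<close> > 0 at 0.\<close>

lemma rgerm_sqrt:
  assumes "rgerm g" "(g \<longlongrightarrow> L) (at 0)" "L > 0"
  shows "rgerm (\<lambda>t. sqrt (g t))"
proof -
  obtain G where G: "G analytic_on {0}" "\<forall>\<^sub>F t in at 0. complex_of_real (g t) = G (complex_of_real t)"
    using assms unfolding cgerm_def by blast
  have "Re (G 0) = L" using rgerm_tendsto(1)[OF G] assms(2) tendsto_unique by force
  then have G0: "G 0 = of_real L" using rgerm_tendsto(2)[OF G] by simp
  have "(\<lambda>z. csqrt (G z)) analytic_on {0}"
    by (intro analytic_intros G) (use G0 assms(3) in auto)
  moreover have "\<forall>\<^sub>F t in at 0. complex_of_real (sqrt (g t)) = csqrt (G (complex_of_real t))"
    using G(2) order_tendstoD(1)[OF assms(2,3)] by eventually_elim (metis of_real_sqrt less_imp_le)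
  ultimately show ?thesis by (rule cgermI)
qed

section \<open>Power sums and elementary symmetric polynomials\<close>

definition psum :: "'a::comm_semiring_1 multiset \<Rightarrow> nat \<Rightarrow> 'a" where
  "psum A j = (\<Sum>x\<in>#A. x ^ j)"

text \<open>The elementary symmetric polynomial with the sign (-1)^m built in, so that it is exactly
  a coefficient of the monic polynomial with roots \<open>A\<close>. The generating function makes
  Newton's identities a statement about a logarithmic derivative.\<close>

definition esym :: "'a::comm_ring_1 multiset \<Rightarrow> nat \<Rightarrow> 'a" where
  "esym A m = fps_nth (\<Prod>x\<in>#A. 1 - fps_const x * fps_X) m"

lemma psum_empty [simp]: "psum {#} j = 0"
  and psum_add_mset [simp]: "psum (add_mset x A) j = x ^ j + psum A j"
  and psum_union [simp]: "psum (A + B) j = psum A j + psum B j"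
  by (simp_all add: psum_def)

lemma psum_0: "psum A 0 = of_nat (size A)"
  by (induction A) auto

lemma esym_0 [simp]: "esym A 0 = 1"
  by (induction A) (auto simp: esym_def fps_mult_nth_0)

lemma esym_empty: "esym {#} m = (if m = 0 then 1 else 0)"
  by (simp add: esym_def)

lemma esym_add_mset_Suc: "esym (add_mset x A) (Suc m) = esym A (Suc m) - x * esym A m"
proof -
  let ?Q = "\<Prod>x\<in>#A. 1 - fps_const x * fps_X"
  have "(1 - fps_const x * fps_X) * ?Q = ?Q - fps_const x * (fps_X * ?Q)"
    by (simp add: algebra_simps)
  then show ?thesis by (simp add: esym_def)
qed

lemma esym_gt_size: "m > size A \<Longrightarrow> esym A m = 0"
proof (induction A arbitrary: m)
  case empty then show ?case by (simp add: esym_empty)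
next
  case (add x A)
  then show ?case by (cases m) (auto simp: esym_add_mset_Suc)
qed

lemma prod_linear_eq_esym:
  fixes A :: "'a::comm_ring_1 multiset"
  shows "(\<Prod>x\<in>#A. X - x) = (\<Sum>m\<le>size A. esym A m * X ^ (size A - m))"
proof (induction A)
  case empty then show ?case by simp
next
  case (add x A)
  let ?n = "size A"
  have "(\<Sum>m\<le>Suc ?n. esym (add_mset x A) m * X ^ (Suc ?n - m)) =
    X ^ Suc ?n + (\<Sum>m\<le>?n. (esym A (Suc m) - x * esym A m) * X ^ (?n - m))"
    by (subst sum.atMost_Suc_shift) (simp add: esym_add_mset_Suc)
  also have "\<dots> = (X ^ Suc ?n + (\<Sum>m\<le>?n. esym A (Suc m) * X ^ (?n - m))) - x * (\<Sum>m\<le>?n. esym A m * X ^ (?n - m))"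
    by (simp add: algebra_simps sum_subtractf sum_distrib_left)
  also have "X ^ Suc ?n + (\<Sum>m\<le>?n. esym A (Suc m) * X ^ (?n - m)) =
      (\<Sum>m\<le>Suc ?n. esym A m * X ^ (Suc ?n - m))"
    by (subst sum.atMost_Suc_shift) simp
  also have "\<dots> = X * (\<Sum>m\<le>?n. esym A m * X ^ (?n - m))"
    by (simp add: esym_gt_size sum_distrib_left Suc_diff_le algebra_simps)
  finally show ?case by (simp add: add.IH algebra_simps)
qed

text \<open>Compare coefficients in Q' = - Q S, where Q is the product of the factors 1 - x X and S
  is the generating function of the power sums: each factor contributes -x / (1 - x X) to Q' /
  Q.\<close>

lemma newton_identity:
  fixes A :: "'a::field_char_0 multiset"
  shows "of_nat (Suc m) * esym A (Suc m) = - (\<Sum>i\<le>m. esym A i * psum A (Suc (m - i)))"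
proof -
  define Q where "Q A = (\<Prod>x\<in>#A. 1 - fps_const x * fps_X)" for A :: "'a multiset"
  define S where "S A = Abs_fps (\<lambda>i. psum A (Suc i))" for A :: "'a multiset"
  have "fps_deriv (Q A) = - (Q A * S A)"
  proof (induction A)
    case empty
    have "S {#} = 0" by (simp add: S_def fps_eq_iff)
    then show ?case by (simp add: Q_def)
  next
    case (add x A)
    \<comment> \<open>The geometric series x / (1 - x X), characterised by its product with the
      denominator.\<close>
    define G where "G = Abs_fps (\<lambda>i. x ^ Suc i)"
    have G: "(1 - fps_const x * fps_X) * G = fps_const x"
    proof (rule fps_ext)
      fix i
      have "(1 - fps_const x * fps_X) * G = G - fps_const x * (fps_X * G)" by (simp add: algebra_simps)
      then show "fps_nth ((1 - fps_const x * fps_X) * G) i = fps_nth (fps_const x) i"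
        by (cases i) (auto simp: G_def)
    qed
    have S: "S (add_mset x A) = G + S A" by (simp add: S_def G_def fps_eq_iff)
    have Q: "Q (add_mset x A) = (1 - fps_const x * fps_X) * Q A" by (simp add: Q_def)
    have "fps_deriv (Q (add_mset x A)) = - fps_const x * Q A + (1 - fps_const x * fps_X) * fps_deriv (Q A)"
      unfolding Q by (simp add: algebra_simps flip: fps_const_neg)
    also have "\<dots> = - ((1 - fps_const x * fps_X) * G) * Q A - (1 - fps_const x * fps_X) * (Q A * S A)"
      unfolding G add.IH by simp
    also have "\<dots> = - (Q (add_mset x A) * S (add_mset x A))"
      unfolding Q S by (simp add: algebra_simps)
    finally show ?case .
  qed
  then have "fps_nth (fps_deriv (Q A)) m = fps_nth (- (Q A * S A)) m" by simp
  then show ?thesis by (simp add: Q_def S_def esym_def fps_mult_nth atLeast0AtMost)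
qed

text \<open>In characteristic 0 Newton's identities can be solved recursively for
  \<open>esym\<close>.\<close>

lemma esym_eqI_psum:
  fixes A B :: "'a::field_char_0 multiset"
  assumes "\<And>j. psum A j = psum B j"
  shows "esym A m = esym B m"
proof (induction m rule: less_induct)
  case (less m)
  show ?case
  proof (cases m)
    case 0 then show ?thesis by simp
  next
    case (Suc l)
    have "of_nat (Suc l) * esym A (Suc l) = of_nat (Suc l) * esym B (Suc l)"
      unfolding newton_identity assms using less.IH Suc by simp
    then show ?thesis unfolding Suc by (subst (asm) mult_cancel_left) (simp del: of_nat_Suc)
  qed
qed

lemma proots_prod_linear: "proots (\<Prod>x\<in>#A. [:- x, 1:]) = (A :: 'a::idom multiset)"
proof (induction A)
  case (add x A)
  have "(\<Prod>x\<in>#A. [:- x, 1:]) \<noteq> 0" by (auto simp: prod_mset_zero_iff)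
  then have "proots ([:- x, 1:] * (\<Prod>x\<in>#A. [:- x, 1:])) = {#x#} + A"
    using add by (subst proots_mult) auto
  then show ?case by (simp del: mult_pCons_left)
qed simp

lemma poly_prod_linear:
  fixes A :: "'a::comm_ring_1 multiset"
  shows "poly (\<Prod>x\<in>#A. [:- x, 1:]) X = (\<Prod>x\<in>#A. X - x)"
  by (induction A) (auto simp: left_diff_distrib)

text \<open>The power sum with j = 0 gives the size and the others give the coefficients, so the
  monic polynomials with these roots agree. This is what later identifies the limits at t = 0 with
  the spectrum of \<open>H 0\<close>.\<close>

lemma multiset_eqI_psum:
  fixes A B :: "'a::field_char_0 multiset"
  assumes "\<And>j. psum A j = psum B j"
  shows "A = B"
proof -
  have size: "size A = size B" using assms[of 0] by (simp add: psum_0)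
  have "poly (\<Prod>x\<in>#A. [:- x, 1:]) = poly (\<Prod>x\<in>#B. [:- x, 1:])"
    unfolding poly_prod_linear prod_linear_eq_esym esym_eqI_psum[OF assms] size ..
  then have "(\<Prod>x\<in>#A. [:- x, 1:]) = (\<Prod>x\<in>#B. [:- x, 1:])"
    using poly_eq_poly_eq_iff by blast
  then show ?thesis using proots_prod_linear by metis
qed

lemma psum_image_of_real: "psum (image_mset of_real A) j = (of_real (psum A j) :: 'a::{real_algebra_1, comm_ring_1})"
  by (induction A) auto

lemma esym_image_of_real: "esym (image_mset of_real A) m = (of_real (esym A m) :: 'a::{real_algebra_1, comm_ring_1})"
proof (induction A arbitrary: m)
  case (add x A)
  then show ?case by (cases m) (auto simp: esym_add_mset_Suc)
qed (auto simp: esym_empty)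

lemma rgerm_esym:
  assumes "\<And>j. rgerm (\<lambda>t. psum (M t) j)"
  shows "rgerm (\<lambda>t. esym (M t) m)"
proof (induction m rule: less_induct)
  case (less m)
  show ?case
  proof (cases m)
    case (Suc l)
    have eq: "complex_of_real (esym (M t) m) =
      - (\<Sum>i\<le>l. of_real (esym (M t) i) * of_real (psum (M t) (Suc (l - i)))) / of_nat (Suc l)" for t
    proof -
      have "of_nat (Suc l) * complex_of_real (esym (M t) m) = of_real (of_nat (Suc l) * esym (M t) (Suc l))"
        by (simp add: Suc)
      also have "\<dots> = - (\<Sum>i\<le>l. of_real (esym (M t) i) * of_real (psum (M t) (Suc (l - i))))"
        unfolding newton_identity by simp
      finally show ?thesis by (simp add: field_simps del: of_nat_Suc)
    qed
    show ?thesis unfolding eq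
      by (intro cgerm_divide_const cgerm_minus cgerm_sum cgerm_mult less.IH assms) (use Suc in auto)
  qed simp
qed

section \<open>Splitting off a cluster of roots\<close>

lemma has_contour_integral_power_cauchy:
  assumes "\<rho> > 0" "dist a x \<noteq> \<rho>"
  shows "((\<lambda>X. X ^ j * (1 / (X - x))) has_contour_integral
    (if dist a x < \<rho> then 2 * of_real pi * \<i> * x ^ j else 0)) (circlepath a \<rho>)"
proof (cases "dist a x < \<rho>")
  case True
  have "((\<lambda>X. X ^ j / (X - x)) has_contour_integral 2 * of_real pi * \<i> * x ^ j) (circlepath a \<rho>)"
    by (rule Cauchy_integral_circlepath_simple)
       (use True in \<open>auto intro!: holomorphic_intros simp: dist_norm norm_minus_commute\<close>)
  then show ?thesis using True by simp
next
  case False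
  then have gt: "dist a x > \<rho>" using assms by simp
  have "((\<lambda>X. X ^ j * (1 / (X - x))) has_contour_integral 0) (circlepath a \<rho>)"
  proof (rule Cauchy_theorem_disc_simple)
    \<comment> \<open>The concentric disc reaching out to the pole \<open>x\<close> contains the
      circle and excludes the pole.\<close>
    show "(\<lambda>X. X ^ j * (1 / (X - x))) holomorphic_on ball a (dist a x)"
      by (auto intro!: holomorphic_intros)
  qed (use gt assms in auto)
  then show ?thesis using False by simp
qed

text \<open>Cauchy's formula root by root: the circle selects the roots inside it and weights each
  by its j-th power.\<close>

lemma has_contour_integral_psum_filter:
  assumes "\<rho> > 0" "\<forall>x\<in>#A. dist a x \<noteq> \<rho>"
  shows "((\<lambda>X. X ^ j * (\<Sum>x\<in>#A. 1 / (X - x))) has_contour_integral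
    2 * of_real pi * \<i> * psum (filter_mset (\<lambda>x. dist a x < \<rho>) A) j) (circlepath a \<rho>)"
  using assms(2)
proof (induction A)
  case empty
  then show ?case by (simp add: has_contour_integral_0)
next
  case (add x A)
  have "((\<lambda>X. X ^ j * (1 / (X - x)) + X ^ j * (\<Sum>x\<in>#A. 1 / (X - x))) has_contour_integral
     ((if dist a x < \<rho> then 2 * of_real pi * \<i> * x ^ j else 0) +
      2 * of_real pi * \<i> * psum (filter_mset (\<lambda>x. dist a x < \<rho>) A) j)) (circlepath a \<rho>)"
    by (intro has_contour_integral_add has_contour_integral_power_cauchy assms add.IH)
       (use add.prems in auto)
  then show ?case by (cases "dist a x < \<rho>") (simp_all add: ring_distribs)
qed

section \<open>The logarithmic derivative expressed by coefficients\<close>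

lemma DERIV_prod_linear:
  fixes A :: "'a::real_normed_field multiset"
  assumes "X \<notin># A"
  shows "((\<lambda>X. \<Prod>x\<in>#A. X - x) has_field_derivative (\<Prod>x\<in>#A. X - x) * (\<Sum>x\<in>#A. 1 / (X - x))) (at X)"
  using assms
proof (induction A)
  case (add x A)
  have "((\<lambda>X. (X - x) * (\<Prod>x\<in>#A. X - x)) has_field_derivative
     (1 - 0) * (\<Prod>x\<in>#A. X - x) + ((\<Prod>x\<in>#A. X - x) * (\<Sum>x\<in>#A. 1 / (X - x))) * (X - x)) (at X)"
    by (intro DERIV_mult DERIV_diff DERIV_ident DERIV_const add.IH) (use add.prems in auto)
  moreover have "X - x \<noteq> 0" using add.prems by auto
  then have "(X - x) * P * (1 / (X - x) + S) = (1 - 0) * P + P * S * (X - x)" for P S :: 'a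
    by (simp add: distrib_left)
  ultimately show ?case by simp
qed simp

definition pol :: "nat \<Rightarrow> (nat \<Rightarrow> 'a) \<Rightarrow> 'a \<Rightarrow> 'a::real_normed_field" where
  "pol n c X = (\<Sum>m\<le>n. c m * X ^ (n - m))"

text \<open>The X-derivative of \<open>pol\<close>. For m = n the truncated exponent
  \<open>n - m - 1\<close> does no harm, since the factor \<open>of_nat (n - m)\<close> is
  0.\<close>

definition dpol :: "nat \<Rightarrow> (nat \<Rightarrow> 'a) \<Rightarrow> 'a \<Rightarrow> 'a::real_normed_field" where
  "dpol n c X = (\<Sum>m\<le>n. c m * (of_nat (n - m) * X ^ (n - m - 1)))"

lemma DERIV_pol: "(pol n c has_field_derivative dpol n c X) (at X)"
  unfolding pol_def[abs_def] dpol_def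
  by (rule derivative_eq_intros refl sum.cong | simp)+

lemma pol_esym: "pol (size A) (esym A) X = (\<Prod>x\<in>#A. X - x)"
  by (simp add: pol_def prod_linear_eq_esym)

text \<open>The left side involves only coefficients, so it can be continued holomorphically in a
  parameter even though nothing is known yet about how the single roots vary.\<close>

lemma dpol_divide_pol:
  assumes "pol (size A) (esym A) X \<noteq> 0"
  shows "dpol (size A) (esym A) X / pol (size A) (esym A) X = (\<Sum>x\<in>#A. 1 / (X - x))"
proof -
  have nz: "(\<Prod>x\<in>#A. X - x) \<noteq> 0" using assms by (simp add: pol_esym)
  then have "X \<notin># A" by (auto simp: prod_mset_zero_iff)
  from DERIV_prod_linear[OF this] DERIV_pol[of "size A" "esym A" X]
  have d: "dpol (size A) (esym A) X = (\<Prod>x\<in>#A. X - x) * (\<Sum>x\<in>#A. 1 / (X - x))"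
    unfolding pol_esym[abs_def] by (rule DERIV_unique[rotated])
  show ?thesis unfolding pol_esym d using nz by (rule nonzero_mult_div_cancel_left)
qed

text \<open>Compactness of the circle gives a positive minimum of the modulus at z = 0; a
  perturbation of the finitely many coefficients that moves the polynomial by less than this minimum
  creates no zero on the circle.\<close>

lemma pol_nonzero_near:
  assumes C: "\<And>m. C m analytic_on {0}" and nz: "\<forall>X\<in>sphere a \<rho>. pol n (\<lambda>m. C m 0) X \<noteq> 0" and "\<rho> > 0"
  shows "\<exists>r>0. (\<forall>m\<le>n. C m holomorphic_on ball 0 r) \<and>
    (\<forall>z\<in>ball 0 r. \<forall>X\<in>sphere a \<rho>. pol n (\<lambda>m. C m z) X \<noteq> (0::complex))"
proof -
  let ?P = "\<lambda>z. pol n (\<lambda>m. C m z)"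
  have cont: "continuous_on (sphere a \<rho>) (\<lambda>X. norm (?P 0 X))"
    unfolding pol_def by (intro continuous_intros)
  have "sphere a \<rho> \<noteq> {}" using \<open>\<rho> > 0\<close> by simp
  then obtain X0 where X0: "X0 \<in> sphere a \<rho>" "\<And>X. X \<in> sphere a \<rho> \<Longrightarrow> norm (?P 0 X0) \<le> norm (?P 0 X)"
    using continuous_attains_inf[OF compact_sphere _ cont] by blast
  define \<delta> where "\<delta> = norm (?P 0 X0)"
  have \<delta>: "\<delta> > 0" using nz X0 by (simp add: \<delta>_def)
  \<comment> \<open>A bound for \<open>norm X\<close> on the circle; the weights
    \<open>R ^ (n - m)\<close> turn changes of the coefficients into a bound for the change of the
    value.\<close>
  define R where "R = norm a + \<rho>"
  have "((\<lambda>z. \<Sum>m\<le>n. norm (C m z - C m 0) * R ^ (n - m)) \<longlongrightarrow> (\<Sum>m\<le>n. norm (C m 0 - C m 0) * R ^ (n - m))) (nhds 0)"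
    by (intro tendsto_intros analytic_at_imp_isCont[OF C, unfolded isCont_def, unfolded tendsto_at_iff_tendsto_nhds])
  then have "\<forall>\<^sub>F z in nhds 0. (\<Sum>m\<le>n. norm (C m z - C m 0) * R ^ (n - m)) < \<delta>"
    by (intro order_tendstoD) (use \<delta> in auto)
  moreover have "\<forall>\<^sub>F z in nhds 0. \<forall>m\<in>{..n}. C m analytic_on {z}"
  proof (intro eventually_ball_finite ballI)
    fix m
    obtain s where "s > 0" "C m holomorphic_on ball 0 s" using C[of m] unfolding analytic_at_ball by blast
    then have "C m analytic_on ball 0 s" by (simp add: analytic_on_open)
    then show "\<forall>\<^sub>F z in nhds 0. C m analytic_on {z}"
      unfolding eventually_nhds
      by (intro exI[of _ "ball 0 s"]) (use \<open>s > 0\<close> in \<open>auto intro: analytic_on_subset\<close>)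
  qed simp
  ultimately have "\<forall>\<^sub>F z in nhds 0. (\<Sum>m\<le>n. norm (C m z - C m 0) * R ^ (n - m)) < \<delta> \<and> (\<forall>m\<in>{..n}. C m analytic_on {z})"
    by eventually_elim simp
  then obtain r where r: "r > 0" "\<And>z. dist z 0 < r \<Longrightarrow> (\<Sum>m\<le>n. norm (C m z - C m 0) * R ^ (n - m)) < \<delta>"
    "\<And>z m. dist z 0 < r \<Longrightarrow> m \<le> n \<Longrightarrow> C m analytic_on {z}"
    unfolding eventually_nhds_metric by auto
  have "?P z X \<noteq> 0" if "z \<in> ball 0 r" "X \<in> sphere a \<rho>" for z X
  proof
    assume "?P z X = 0"
    have "norm X \<le> R"
      using that norm_triangle_ineq[of a "X - a"] by (simp add: R_def dist_norm norm_minus_commute)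
    have "\<delta> \<le> norm (?P 0 X)" using X0 that by (simp add: \<delta>_def)
    also have "\<dots> = norm (?P z X - ?P 0 X)" using \<open>?P z X = 0\<close> by simp
    also have "\<dots> = norm (\<Sum>m\<le>n. (C m z - C m 0) * X ^ (n - m))"
      by (simp add: pol_def sum_subtractf left_diff_distrib)
    also have "\<dots> \<le> (\<Sum>m\<le>n. norm (C m z - C m 0) * R ^ (n - m))"
      by (intro sum_norm_le) (auto simp: norm_mult norm_power intro!: mult_left_mono power_mono \<open>norm X \<le> R\<close>)
    also have "\<dots> < \<delta>" using r(2) that by (simp add: dist_commute)
    finally show False by simp
  qed
  moreover have "C m holomorphic_on ball 0 r" if "m \<le> n" for m
  proof -
    have "C m analytic_on ball 0 r"
      using r(3)[OF _ that] by (subst analytic_on_analytic_at) (auto simp: dist_commute)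
    then show ?thesis by (rule analytic_imp_holomorphic)
  qed
  ultimately show ?thesis using r(1) by blast
qed

text \<open>Differentiation under the integral sign over the parameter interval [0,1]. Since
  \<open>pol\<close> has no zero on the circle, the integrand is holomorphic in z and its
  z-derivative is jointly continuous.\<close>

lemma holomorphic_contour_log_deriv:
  assumes C: "\<And>m. m \<le> n \<Longrightarrow> C m holomorphic_on ball 0 r"
    and nz: "\<And>z X. z \<in> ball 0 r \<Longrightarrow> X \<in> sphere a \<rho> \<Longrightarrow> pol n (\<lambda>m. C m z) X \<noteq> 0" and "\<rho> > 0"
  shows "(\<lambda>z. contour_integral (circlepath a \<rho>)
    (\<lambda>X. X ^ j * (dpol n (\<lambda>m. C m z) X / pol n (\<lambda>m. C m z) X))) holomorphic_on ball 0 r"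
proof -
  let ?\<gamma> = "circlepath a \<rho>"
  \<comment> \<open>The derivative of the parametrisation \<open>circlepath\<close>.\<close>
  define v where "v s = 2 * pi * \<i> * \<rho> * exp (2 * of_real pi * \<i> * of_real s)" for s :: real
  let ?P = "\<lambda>z. pol n (\<lambda>m. C m z)" and ?Q = "\<lambda>z. dpol n (\<lambda>m. C m z)"
  let ?P' = "\<lambda>z. pol n (\<lambda>m. deriv (C m) z)" and ?Q' = "\<lambda>z. dpol n (\<lambda>m. deriv (C m) z)"
  have \<gamma>: "?\<gamma> s \<in> sphere a \<rho>" if "s \<in> cbox 0 1" for s
  proof -
    have "?\<gamma> s \<in> path_image ?\<gamma>" using that by (auto simp: path_image_def)
    then show ?thesis using \<open>\<rho> > 0\<close> by simp
  qed
  have DC: "(C m has_field_derivative deriv (C m) z) (at z within ball 0 r)" if "z \<in> ball 0 r" "m \<le> n" for z m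
    using holomorphic_derivI[OF C[OF that(2)] open_ball that(1)] by (rule has_field_derivative_at_within)
  have DP: "((\<lambda>z. ?P z X) has_field_derivative ?P' z X) (at z within ball 0 r)" if "z \<in> ball 0 r" for z X
    unfolding pol_def by (intro DERIV_sum DERIV_cmult_right DC that) auto
  have DQ: "((\<lambda>z. ?Q z X) has_field_derivative ?Q' z X) (at z within ball 0 r)" if "z \<in> ball 0 r" for z X
    unfolding dpol_def by (intro DERIV_sum DERIV_cmult_right DC that) auto
  have c\<gamma>: "continuous_on S ?\<gamma>" for S unfolding circlepath by (intro continuous_intros)
  have cC: "continuous_on (ball 0 r) (C m)" "continuous_on (ball 0 r) (deriv (C m))" if "m \<le> n" for m
    using C[OF that] holomorphic_deriv[OF C[OF that] open_ball] by (auto intro: holomorphic_on_imp_continuous_on)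
  let ?U = "ball (0::complex) r \<times> cbox (0::real) 1"
  have c1: "continuous_on ?U (\<lambda>p. C m (fst p))" "continuous_on ?U (\<lambda>p. deriv (C m) (fst p))" if "m \<le> n" for m
    by (rule continuous_on_compose2[OF cC(1)[OF that]] continuous_on_compose2[OF cC(2)[OF that]];
        auto intro!: continuous_intros)+
  have c2: "continuous_on ?U (\<lambda>p. ?\<gamma> (snd p))"
    by (rule continuous_on_compose2[OF c\<gamma>[of UNIV]]) (auto intro!: continuous_intros)
  have cPQ: "continuous_on ?U (\<lambda>p. ?P (fst p) (?\<gamma> (snd p)))" "continuous_on ?U (\<lambda>p. ?Q (fst p) (?\<gamma> (snd p)))"
    "continuous_on ?U (\<lambda>p. ?P' (fst p) (?\<gamma> (snd p)))" "continuous_on ?U (\<lambda>p. ?Q' (fst p) (?\<gamma> (snd p)))"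
    unfolding pol_def dpol_def by (intro continuous_intros c1 c2; simp)+
  have "(\<lambda>z. integral (cbox 0 1) (\<lambda>s. ?\<gamma> s ^ j * (?Q z (?\<gamma> s) / ?P z (?\<gamma> s)) * v s)) holomorphic_on ball 0 r"
  proof (rule leibniz_rule_holomorphic)
    fix z s assume z: "z \<in> ball (0::complex) r" and s: "s \<in> cbox (0::real) 1"
    show "((\<lambda>z. ?\<gamma> s ^ j * (?Q z (?\<gamma> s) / ?P z (?\<gamma> s)) * v s) has_field_derivative
      ?\<gamma> s ^ j * ((?Q' z (?\<gamma> s) * ?P z (?\<gamma> s) - ?Q z (?\<gamma> s) * ?P' z (?\<gamma> s)) / (?P z (?\<gamma> s) * ?P z (?\<gamma> s))) * v s)
      (at z within ball 0 r)"
      by (intro DERIV_cmult_right DERIV_cmult DERIV_divide DP DQ z nz \<gamma> s)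
  next
    fix z assume z: "z \<in> ball (0::complex) r"
    show "(\<lambda>s. ?\<gamma> s ^ j * (?Q z (?\<gamma> s) / ?P z (?\<gamma> s)) * v s) integrable_on cbox 0 1"
    proof (rule integrable_continuous)
      have "continuous_on (cbox 0 1) (\<lambda>s. ?P z (?\<gamma> s))" "continuous_on (cbox 0 1) (\<lambda>s. ?Q z (?\<gamma> s))"
        unfolding pol_def dpol_def by (intro continuous_intros c\<gamma>)+
      then show "continuous_on (cbox 0 1) (\<lambda>s. ?\<gamma> s ^ j * (?Q z (?\<gamma> s) / ?P z (?\<gamma> s)) * v s)"
        unfolding v_def by (intro continuous_intros c\<gamma>) (use nz[OF z] \<gamma> in auto)
    qed
  next
    show "continuous_on ?U (\<lambda>(z, s). ?\<gamma> s ^ j *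
      ((?Q' z (?\<gamma> s) * ?P z (?\<gamma> s) - ?Q z (?\<gamma> s) * ?P' z (?\<gamma> s)) / (?P z (?\<gamma> s) * ?P z (?\<gamma> s))) * v s)"
      unfolding v_def case_prod_unfold
      by (intro continuous_intros cPQ c2) (use nz \<gamma> in auto)
  qed simp
  then show ?thesis
    unfolding contour_integral_integral vector_derivative_circlepath v_def by (simp add: mult_ac)
qed

section \<open>Separating the roots close to one limit root\<close>

lemma prod_mset_ge_power:
  fixes c :: complex
  assumes "\<forall>x\<in>#A. norm (c - x) \<ge> \<rho>" "\<rho> > 0"
  shows "norm (\<Prod>x\<in>#A. c - x) \<ge> \<rho> ^ size A"
  using assms(1)
proof (induction A)
  case (add x A)
  then have "\<rho> * \<rho> ^ size A \<le> norm (c - x) * norm (\<Prod>x\<in>#A. c - x)"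
    using assms(2) by (intro mult_mono) auto
  then show ?case by (simp add: norm_mult)
qed simp

lemma filter_mset_eq_empty: "filter_mset Q A = {#} \<longleftrightarrow> (\<forall>x\<in>#A. \<not> Q x)"
  by (induction A) auto

lemma eventually_eq_nat_limit:
  assumes "((\<lambda>t. real (f t)) \<longlongrightarrow> l) F"
  shows "\<exists>d. \<forall>\<^sub>F t in F. f t = d"
proof -
  have "\<forall>\<^sub>F t in F. dist (real (f t)) l < 1 / 2" using tendstoD[OF assms, of "1 / 2"] by simp
  \<comment> \<open>The witness is the limit rounded to the nearest integer.\<close>
  then have "\<forall>\<^sub>F t in F. f t = nat \<lfloor>l + 1 / 2\<rfloor>"
  proof eventually_elim
    case (elim t)
    then have "\<lfloor>l + 1 / 2\<rfloor> = int (f t)" by (intro floor_unique) (auto simp: dist_real_def abs_if split: if_splits)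
    then show ?case by simp
  qed
  then show ?thesis by blast
qed

text \<open>The limit polynomial has root sum 0 but nonzero sum of squares, hence at least two
  distinct roots. A small fixed circle around one of them splits \<open>M t\<close> for all t near 0
  by a predicate \<open>Q\<close> that does not depend on t, and contour integrals show that the
  power sums of the inner part are germs.\<close>

lemma cluster_split:
  assumes psum: "\<And>j. rgerm (\<lambda>t. psum (M t) j)" and size: "\<forall>\<^sub>F t in at 0. size (M t) = n"
    and lim1: "((\<lambda>t. psum (M t) 1) \<longlongrightarrow> 0) (at 0)" and lim2: "((\<lambda>t. psum (M t) 2) \<longlongrightarrow> L) (at 0)" and L: "L \<noteq> 0"
  shows "\<exists>Q d. 0 < d \<and> d < n \<and> (\<forall>j. rgerm (\<lambda>t. psum (filter_mset Q (M t)) j)) \<and>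
    (\<forall>\<^sub>F t in at 0. size (filter_mset Q (M t)) = d)"
proof -
  have "\<exists>C. C analytic_on {0} \<and> (\<forall>\<^sub>F t in at 0. complex_of_real (esym (M t) m) = C (complex_of_real t))" for m
    using rgerm_esym[OF psum] unfolding cgerm_def by blast
  then obtain C where C: "\<And>m. C m analytic_on {0}"
    "\<And>m. \<forall>\<^sub>F t in at 0. complex_of_real (esym (M t) m) = C m (complex_of_real t)" by metis
  define N where "N t = image_mset complex_of_real (M t)" for t
  have evC: "\<forall>\<^sub>F t in at 0. size (N t) = n \<and> (\<forall>m\<le>n. C m (complex_of_real t) = esym (N t) m)"
  proof -
    have "\<forall>\<^sub>F t in at 0. \<forall>m\<in>{..n}. complex_of_real (esym (M t) m) = C m (complex_of_real t)"
      by (intro eventually_ball_finite ballI C) simp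
    then show ?thesis using size by eventually_elim (auto simp: N_def esym_image_of_real)
  qed
  have pol_eq: "pol n (\<lambda>m. C m z) X = pol (size A) (esym A) X" "dpol n (\<lambda>m. C m z) X = dpol (size A) (esym A) X"
    if "size A = n \<and> (\<forall>m\<le>n. C m z = esym A m)" for A z X
    using that by (auto simp: pol_def dpol_def)

  define c where "c m = C m 0" for m
  have limC: "((\<lambda>t. complex_of_real (esym (M t) m)) \<longlongrightarrow> c m) (at 0)" for m
    unfolding c_def using analytic_at_0_tendsto[OF C(1)]
    by (rule Lim_transform_eventually) (use C(2)[of m] in eventually_elim, simp)
  have c0: "c 0 = 1" using limC[of 0] by (simp add: tendsto_const_iff)
  \<comment> \<open>The first two Newton identities; they turn the limits of the power sums into c 1
    = 0 and c 2 = -L/2.\<close>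
  have esym1: "esym A (Suc 0) = - psum A 1" and esym2: "2 * esym A 2 = - (psum A 2 + esym A (Suc 0) * psum A 1)"
    for A :: "'a::field_char_0 multiset"
    using newton_identity[of 0 A] newton_identity[of 1 A] by (simp_all add: numeral_2_eq_2)
  have c1: "c (Suc 0) = 0"
  proof (rule tendsto_unique[OF _ limC])
    have "((\<lambda>t. complex_of_real (- psum (M t) 1)) \<longlongrightarrow> of_real (- 0)) (at 0)"
      by (intro tendsto_intros lim1)
    then show "((\<lambda>t. complex_of_real (esym (M t) (Suc 0))) \<longlongrightarrow> 0) (at 0)" by (simp add: esym1)
  qed simp
  have c2: "2 * c 2 = - of_real L"
  proof (rule tendsto_unique)
    show "((\<lambda>t. 2 * complex_of_real (esym (M t) 2)) \<longlongrightarrow> 2 * c 2) (at 0)" by (intro tendsto_intros limC)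
    have "((\<lambda>t. complex_of_real (- (psum (M t) 2 + - psum (M t) 1 * psum (M t) 1))) \<longlongrightarrow> of_real (- (L + - 0 * 0))) (at 0)"
      by (intro tendsto_intros lim1 lim2)
    moreover have "2 * complex_of_real (esym (M t) 2) = of_real (- (psum (M t) 2 + - psum (M t) 1 * psum (M t) 1))" for t
      using esym2[of "M t"] unfolding esym1 by (metis of_real_mult of_real_numeral)
    ultimately show "((\<lambda>t. 2 * complex_of_real (esym (M t) 2)) \<longlongrightarrow> - of_real L) (at 0)" by simp
  qed simp

  define p where "p = (\<Sum>m\<le>n. monom (c m) (n - m))"
  have coeff_p: "coeff p i = (if i \<le> n then c (n - i) else 0)" for i
  proof -
    have "coeff p i = (\<Sum>m\<le>n. if m = n - i \<and> i \<le> n then c m else 0)"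
      unfolding p_def coeff_sum by (intro sum.cong) auto
    then show ?thesis by (simp add: sum.delta')
  qed
  have poly_p: "poly p X = pol n c X" for X
    by (simp add: p_def pol_def poly_sum poly_monom)
  have deg: "degree p = n"
    by (rule antisym[OF degree_le le_degree]) (auto simp: coeff_p c0)
  have "p \<noteq> 0" using coeff_p[of n] c0 by auto
  define M0 where "M0 = proots p"
  have size0: "size M0 = n" using deg by (simp add: M0_def size_proots_complex)
  have p_prod: "p = (\<Prod>x\<in>#M0. [:-x, 1:])"
    using complex_poly_decompose_multiset[of p] deg coeff_p[of n] c0 by (simp add: M0_def)
  have esym0: "esym M0 m = c m" if "m \<le> n" for m
  proof -
    define q where "q = (\<Sum>m\<le>n. monom (esym M0 m) (n - m))"
    have "poly q X = poly p X" for X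
      unfolding p_prod poly_prod_linear prod_linear_eq_esym
      by (simp add: q_def poly_sum poly_monom size0)
    then have "q = p" by (simp add: poly_eq_poly_eq_iff[symmetric] fun_eq_iff)
    moreover have "coeff q (n - m) = (\<Sum>l\<le>n. if l = m then esym M0 l else 0)"
      unfolding q_def coeff_sum using that by (intro sum.cong) auto
    ultimately show ?thesis using coeff_p[of "n - m"] that by simp
  qed
  have cgt: "c m = 0" if "m > n" for m
  proof (rule tendsto_unique[OF _ limC])
    show "((\<lambda>t. complex_of_real (esym (M t) m)) \<longlongrightarrow> 0) (at 0)"
      by (rule tendsto_eventually) (use size in eventually_elim, use that in \<open>simp add: esym_gt_size\<close>)
  qed simp
  have esym0': "esym M0 m = c m" for m
    by (cases "m \<le> n") (auto simp: esym0 cgt esym_gt_size size0)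
  \<comment> \<open>The same two identities read backwards, from the coefficients of
    \<open>p\<close> to the power sums of its roots.\<close>
  have p1: "psum M0 1 = 0" using esym1[of M0] c1 esym0' by simp
  have p2: "psum M0 2 \<noteq> 0" using esym2[of M0] c2 esym0' p1 L by auto

  \<comment> \<open>If every root were equal to \<open>a\<close>, the sum of squares would be
    \<open>a\<close> times the sum, which is 0.\<close>
  obtain a b where ab: "a \<in># M0" "b \<in># M0" "a \<noteq> b"
  proof -
    have "M0 \<noteq> {#}" using p2 by auto
    then obtain a where a: "a \<in># M0" by blast
    have "\<exists>b. b \<in># M0 \<and> a \<noteq> b"
    proof (rule ccontr)
      assume "\<not> ?thesis"
      then have "psum M0 2 = (\<Sum>x\<in>#M0. a * x ^ 1)"
        unfolding psum_def by (intro arg_cong[where f = sum_mset] image_mset_cong) (auto simp: power2_eq_square)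
      also have "\<dots> = a * psum M0 1" by (simp add: psum_def sum_mset_distrib_left)
      finally show False using p1 p2 by simp
    qed
    then show ?thesis using a that by blast
  qed
  obtain e where e: "e > 0" "\<And>x. x \<in># M0 \<Longrightarrow> x \<noteq> a \<Longrightarrow> e \<le> dist a x"
    using finite_set_avoid[of "set_mset M0" a] by auto
  \<comment> \<open>Half of a lower bound for the distance from \<open>a\<close> to the other roots:
    the circle meets no root of \<open>p\<close>, and a point within \<open>\<rho>\<close> of
    \<open>a\<close> stays at least \<open>\<rho>\<close> away from every other root.\<close>
  define \<rho> where "\<rho> = e / 2"
  have \<rho>: "\<rho> > 0" using e by (simp add: \<rho>_def)
  have root_iff: "pol n c X = 0 \<longleftrightarrow> X \<in># M0" for X
    using \<open>p \<noteq> 0\<close> by (simp add: M0_def poly_p)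
  have nz: "\<forall>X\<in>sphere a \<rho>. pol n (\<lambda>m. C m 0) X \<noteq> 0"
  proof
    fix X assume X: "X \<in> sphere a \<rho>"
    have "X \<notin># M0" using e(2)[of X] X e(1) by (cases "X = a") (auto simp: \<rho>_def)
    then show "pol n (\<lambda>m. C m 0) X \<noteq> 0" using root_iff[of X] by (simp add: c_def[abs_def])
  qed
  obtain r where r: "r > 0" "\<And>m. m \<le> n \<Longrightarrow> C m holomorphic_on ball 0 r"
    "\<And>z X. z \<in> ball 0 r \<Longrightarrow> X \<in> sphere a \<rho> \<Longrightarrow> pol n (\<lambda>m. C m z) X \<noteq> 0"
    using pol_nonzero_near[of C a \<rho> n] C(1) nz \<rho> by metis
  define I where "I j z = contour_integral (circlepath a \<rho>)
    (\<lambda>X. X ^ j * (dpol n (\<lambda>m. C m z) X / pol n (\<lambda>m. C m z) X)) / (2 * of_real pi * \<i>)" for j z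
  have I: "I j analytic_on {0}" for j
  proof -
    have "I j holomorphic_on ball 0 r"
      unfolding I_def by (intro holomorphic_intros holomorphic_contour_log_deriv r \<rho>) auto
    then show ?thesis using r(1) unfolding analytic_at_ball by blast
  qed
  define Q where "Q x = (dist a (complex_of_real x) < \<rho>)" for x
  have ball: "\<forall>\<^sub>F t in at 0. complex_of_real t \<in> ball 0 r"
    by (rule eventually_at_0_of_real, rule eventually_at_in_open') (use r in auto)
  have psumI: "\<forall>\<^sub>F t in at 0. complex_of_real (psum (filter_mset Q (M t)) j) = I j (complex_of_real t)" for j
    using evC ball
  proof eventually_elim
    case (elim t)
    note eq = pol_eq[OF elim(1)]
    have nz: "pol (size (N t)) (esym (N t)) X \<noteq> 0" if "X \<in> sphere a \<rho>" for X
      using r(3)[OF elim(2) that] unfolding eq .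
    have "\<forall>x\<in>#N t. dist a x \<noteq> \<rho>"
    proof (intro ballI notI)
      fix x assume "x \<in># N t" "dist a x = \<rho>"
      then show False using nz[of x] unfolding pol_esym by (auto simp: prod_mset_zero_iff)
    qed
    from has_contour_integral_psum_filter[OF \<rho> this, of j]
    have "((\<lambda>X. X ^ j * (dpol n (\<lambda>m. C m (of_real t)) X / pol n (\<lambda>m. C m (of_real t)) X)) has_contour_integral
      2 * of_real pi * \<i> * psum (filter_mset (\<lambda>x. dist a x < \<rho>) (N t)) j) (circlepath a \<rho>)"
      by (rule has_contour_integral_eq) (use \<rho> nz in \<open>auto simp: eq dpol_divide_pol\<close>)
    then have "I j (of_real t) = psum (filter_mset (\<lambda>x. dist a x < \<rho>) (N t)) j"
      unfolding I_def by (subst contour_integral_unique) auto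
    also have "filter_mset (\<lambda>x. dist a x < \<rho>) (N t) = image_mset of_real (filter_mset Q (M t))"
      by (simp add: N_def Q_def[abs_def] filter_mset_image_mset)
    finally show ?case by (simp add: psum_image_of_real)
  qed
  have germ: "rgerm (\<lambda>t. psum (filter_mset Q (M t)) j)" for j
    using I psumI by (rule cgermI)
  \<comment> \<open>The power sum with j = 0 counts the cluster. As a germ it has a limit, so this
    integer is eventually constant.\<close>
  obtain l where l: "((\<lambda>t. psum (filter_mset Q (M t)) 0) \<longlongrightarrow> l) (at 0)"
    using rgerm_has_limit[OF germ] by blast
  obtain d where d: "\<forall>\<^sub>F t in at 0. size (filter_mset Q (M t)) = d"
    using eventually_eq_nat_limit[OF l[unfolded psum_0]] by blast

  \<comment> \<open>At a root of the limit polynomial the product of the distances to the roots tends to 0, so some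
    root comes close; this gives \<open>0 < d < n\<close> without counting multiplicities.\<close>
  have far: False if "X \<in># M0" "\<forall>\<^sub>F t in at 0. \<forall>x\<in>#N t. norm (X - x) \<ge> \<rho>" for X
  proof -
    have "((\<lambda>t. pol n (\<lambda>m. C m (complex_of_real t)) X) \<longlongrightarrow> pol n c X) (at 0)"
      unfolding pol_def c_def by (intro tendsto_intros analytic_at_0_tendsto C)
    from tendsto_norm[OF this] have "((\<lambda>t. norm (pol n (\<lambda>m. C m (complex_of_real t)) X)) \<longlongrightarrow> 0) (at 0)"
      using root_iff[of X] that(1) by simp
    moreover have "\<forall>\<^sub>F t in at 0. \<rho> ^ n \<le> norm (pol n (\<lambda>m. C m (complex_of_real t)) X)"
      using that(2) evC
    proof eventually_elim
      case (elim t)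
      then show ?case using prod_mset_ge_power[OF elim(1) \<rho>] unfolding pol_eq[OF elim(2)] pol_esym by simp
    qed
    ultimately have "\<rho> ^ n \<le> 0" by (intro tendsto_lowerbound) auto
    then show False using zero_less_power[OF \<rho>, of n] by linarith
  qed
  have "d > 0"
  proof (rule ccontr)
    assume "\<not> d > 0"
    have "\<forall>\<^sub>F t in at 0. \<forall>x\<in>#N t. norm (a - x) \<ge> \<rho>"
      using d by eventually_elim (use \<open>\<not> d > 0\<close> in \<open>auto simp: N_def Q_def dist_norm filter_mset_eq_empty not_less\<close>)
    then show False using far ab by blast
  qed
  moreover have "d < n"
  proof -
    have "\<forall>\<^sub>F t in at (0::real). d \<le> n"
      using d size by eventually_elim (use size_filter_mset_lesseq in metis)
    moreover have "d \<noteq> n"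
    proof
      assume "d = n"
      \<comment> \<open>With d = n all roots lie within \<open>\<rho>\<close> of \<open>a\<close>,
        so none comes close to \<open>b\<close>, which is at distance at least
        \<open>2 * \<rho>\<close> from \<open>a\<close>.\<close>
      have "\<forall>\<^sub>F t in at 0. \<forall>x\<in>#N t. norm (b - x) \<ge> \<rho>"
        using d size
      proof eventually_elim
        case (elim t)
        have "size (filter_mset Q (M t)) + size (filter_mset (\<lambda>x. \<not> Q x) (M t)) = size (M t)"
          by (metis multiset_partition size_union)
        then have all: "\<forall>x\<in>#M t. Q x" using elim \<open>d = n\<close> by (auto simp: filter_mset_eq_empty)
        show ?case
        proof
          fix x assume "x \<in># N t"
          then have "dist a x < \<rho>" using all by (auto simp: N_def Q_def)
          moreover have "dist a b \<le> dist a x + dist x b" by (rule dist_triangle)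
          moreover have "dist a b \<ge> 2 * \<rho>" using e(2)[OF ab(2)] ab(3) by (simp add: \<rho>_def)
          ultimately show "norm (b - x) \<ge> \<rho>" by (simp add: dist_norm norm_minus_commute)
        qed
      qed
      then show False using far ab by blast
    qed
    ultimately show ?thesis by simp
  qed
  ultimately show ?thesis using germ d by blast
qed

section \<open>Analytic root functions\<close>

lemma psum_shift:
  "psum (image_mset (\<lambda>x. x + c) A) j = (\<Sum>i\<le>j. of_nat (j choose i) * psum A i * c ^ (j - i))"
  for A :: "'a::comm_ring_1 multiset"
proof (induction A)
  case (add x A)
  then show ?case by (simp add: binomial_ring[of x c] sum.distrib distrib_right distrib_left)
qed simp

lemma psum_divide: "psum (image_mset (\<lambda>x. x / c) A) j = psum A j / c ^ j"
  for A :: "'a::field multiset"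
  by (induction A) (auto simp: power_divide add_divide_distrib)

lemma psum_2_nonneg: "psum A 2 \<ge> (0::real)"
  by (induction A) auto

lemma member_power2_le_psum:
  fixes A :: "real multiset"
  assumes "x \<in># A" shows "x\<^sup>2 \<le> psum A 2"
proof -
  obtain B where "A = add_mset x B" using assms by (metis mset_add)
  then show ?thesis using psum_2_nonneg[of B] by simp
qed

lemma abs_psum_le:
  fixes A :: "real multiset"
  assumes "\<forall>x\<in>#A. \<bar>x\<bar> \<le> K" shows "\<bar>psum A j\<bar> \<le> of_nat (size A) * K ^ j"
  using assms
proof (induction A)
  case (add x A)
  have "\<bar>x ^ j + psum A j\<bar> \<le> \<bar>x\<bar> ^ j + \<bar>psum A j\<bar>" by (metis abs_triangle_ineq power_abs)
  also have "\<dots> \<le> K ^ j + of_nat (size A) * K ^ j"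
    using add by (intro add_mono power_mono) auto
  finally show ?case by (simp add: algebra_simps)
qed simp

text \<open>Rellich's theorem for multisets of real numbers. Both parts of a split have fewer than
  \<open>n\<close> elements, so strong induction applies to each; it also stops when all centred
  roots vanish.\<close>

theorem analytic_root_functions:
  assumes "\<And>j. rgerm (\<lambda>t. psum (M t) j)" "\<forall>\<^sub>F t in at 0. size (M t) = n"
  shows "\<exists>fs. length fs = n \<and> (\<forall>f\<in>set fs. rgerm f) \<and> (\<forall>\<^sub>F t in at 0. M t = mset (map (\<lambda>f. f t) fs))"
  using assms
proof (induction n arbitrary: M rule: less_induct)
  case (less n)
  note germ = less.prems(1) and size = less.prems(2)
  show ?case
  proof (cases "n = 0")
    case True
    have "\<forall>\<^sub>F t in at 0. M t = mset (map (\<lambda>f. f t) [])"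
      using size by eventually_elim (use True in simp)
    then show ?thesis using True by (intro exI[of _ "[]"]) simp
  next
    case False
    define c where "c t = psum (M t) 1 / n" for t
    have c: "rgerm c" unfolding c_def using cgerm_divide_const[OF germ[of 1], of "of_nat n"] by simp
    define M1 where "M1 t = image_mset (\<lambda>x. x + - c t) (M t)" for t
    have M_M1: "M t = image_mset (\<lambda>x. c t + x) (M1 t)" for t
      by (simp add: M1_def multiset.map_comp o_def)
    have germ1: "rgerm (\<lambda>t. psum (M1 t) j)" for j
    proof -
      have "cgerm (\<lambda>t. \<Sum>i\<le>j. of_nat (j choose i) * of_real (psum (M t) i) * (- of_real (c t)) ^ (j - i))"
        by (intro cgerm_sum cgerm_mult cgerm_const germ cgerm_power cgerm_minus c)
      then show ?thesis
        unfolding M1_def psum_shift of_real_sum of_real_mult of_real_power of_real_of_nat_eq of_real_minus .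
    qed
    have sum1: "\<forall>\<^sub>F t in at 0. psum (M1 t) 1 = 0"
      using size
    proof eventually_elim
      case (elim t)
      have "psum (M1 t) 1 = psum (M t) 1 - of_nat (size (M t)) * c t"
        unfolding M1_def psum_shift by (simp add: psum_0 atMost_Suc)
      then show ?case using elim False by (simp add: c_def)
    qed
    have "\<forall>\<^sub>F t in at 0. psum (M1 t) 2 \<ge> 0"
      by (intro always_eventually allI psum_2_nonneg)
    from rgerm_factor_nonneg[OF germ1 this] show ?thesis
    proof (elim disjE exE conjE)
      \<comment> \<open>The centred roots all vanish, and the mean repeated \<open>n\<close> times
        is the answer.\<close>
      assume z: "\<forall>\<^sub>F t in at 0. psum (M1 t) 2 = 0"
      have "\<forall>\<^sub>F t in at 0. M t = mset (map (\<lambda>f. f t) (replicate n c))"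
        using z size
      proof eventually_elim
        case (elim t)
        have "x = 0" if "x \<in># M1 t" for x using member_power2_le_psum[OF that] elim by simp
        then have "M1 t = replicate_mset n 0"
          using elim by (metis M1_def set_mset_subset_singletonD singletonI size_image_mset subsetI)
        then show ?case by (subst M_M1) simp
      qed
      then show ?thesis using c by (intro exI[of _ "replicate n c"]) auto
    next
      fix m g L assume g: "rgerm g" "L > 0" "(g \<longlongrightarrow> L) (at 0)"
        and fact: "\<forall>\<^sub>F t in at 0. psum (M1 t) 2 = (t ^ m)\<^sup>2 * g t"
      \<comment> \<open>The scale is chosen so that the sum of squares becomes \<open>g t\<close>,
        whose limit \<open>L\<close> is positive: this is the hypothesis of
        \<open>cluster_split\<close>.\<close>
      define M2 where "M2 t = image_mset (\<lambda>x. x / t ^ m) (M1 t)" for t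
      have M_M2: "\<forall>\<^sub>F t in at 0. M t = image_mset (\<lambda>x. c t + t ^ m * x) (M2 t)"
        using eventually_neq_0 by eventually_elim (subst M_M1, simp add: M2_def multiset.map_comp o_def)
      have size2: "\<forall>\<^sub>F t in at 0. size (M2 t) = n"
        using size by (simp add: M2_def M1_def)
      have psum2: "psum (M2 t) j = psum (M1 t) j / t ^ (m * j)" for t j
        by (simp add: M2_def psum_divide power_mult)
      have sq: "\<forall>\<^sub>F t in at 0. psum (M2 t) 2 = g t"
        using fact eventually_neq_0
      proof eventually_elim
        case (elim t)
        then show ?case by (simp add: psum2 power_mult)
      qed
      \<comment> \<open>The margin 1 is arbitrary. Every rescaled root is bounded by
        \<open>sqrt (L + 1)\<close>, so the rescaled power sums are bounded, as
        \<open>rgerm_divide_power\<close> requires.\<close>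
      have "\<forall>\<^sub>F t in at 0. g t < L + 1" using order_tendstoD(2)[OF g(3), of "L + 1"] by simp
      with sq size2 have bound: "\<forall>\<^sub>F t in at 0. \<bar>psum (M1 t) j / t ^ (m * j)\<bar> \<le> n * sqrt (L + 1) ^ j" for j
      proof eventually_elim
        case (elim t)
        have "\<bar>x\<bar> \<le> sqrt (L + 1)" if "x \<in># M2 t" for x
          using member_power2_le_psum[OF that] elim by (intro real_le_rsqrt) simp
        then have "\<bar>psum (M2 t) j\<bar> \<le> n * sqrt (L + 1) ^ j" using abs_psum_le[of "M2 t"] elim by blast
        then show ?case by (simp add: psum2)
      qed
      have germ2: "rgerm (\<lambda>t. psum (M2 t) j)" for j
        unfolding psum2 by (rule rgerm_divide_power[OF germ1 bound])
      have lim1: "((\<lambda>t. psum (M2 t) 1) \<longlongrightarrow> 0) (at 0)"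
        by (rule tendsto_eventually) (use sum1 in eventually_elim, simp add: psum2)
      have lim2: "((\<lambda>t. psum (M2 t) 2) \<longlongrightarrow> L) (at 0)"
        using g(3) by (rule Lim_transform_eventually) (use sq in eventually_elim, simp)
      obtain Q d where Q: "0 < d" "d < n" "\<And>j. rgerm (\<lambda>t. psum (filter_mset Q (M2 t)) j)"
        "\<forall>\<^sub>F t in at 0. size (filter_mset Q (M2 t)) = d"
        using cluster_split[OF germ2 size2 lim1 lim2] g(2) by auto
      let ?R = "\<lambda>x. \<not> Q x"
      have part: "M2 t = filter_mset Q (M2 t) + filter_mset ?R (M2 t)" for t
        by (rule multiset_partition)
      have germR: "rgerm (\<lambda>t. psum (filter_mset ?R (M2 t)) j)" for j
      proof -
        have "psum (filter_mset ?R (M2 t)) j = psum (M2 t) j - psum (filter_mset Q (M2 t)) j" for t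
          by (subst part) (simp del: filter_union_mset union_filter_mset_complement)
        then show ?thesis using cgerm_diff[OF germ2 Q(3), of j j] by simp
      qed
      have sizeR: "\<forall>\<^sub>F t in at 0. size (filter_mset ?R (M2 t)) = n - d"
        using size2 Q(4)
      proof eventually_elim
        case (elim t)
        have "size (M2 t) = size (filter_mset Q (M2 t)) + size (filter_mset ?R (M2 t))"
          using part by (metis size_union)
        then show ?case using elim by simp
      qed
      obtain fs where fs: "length fs = d" "\<forall>f\<in>set fs. rgerm f"
        "\<forall>\<^sub>F t in at 0. filter_mset Q (M2 t) = mset (map (\<lambda>f. f t) fs)"
        using less.IH[OF Q(2) Q(3) Q(4)] by blast
      obtain gs where gs: "length gs = n - d" "\<forall>f\<in>set gs. rgerm f"
        "\<forall>\<^sub>F t in at 0. filter_mset ?R (M2 t) = mset (map (\<lambda>f. f t) gs)"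
        using less.IH[OF _ germR sizeR] Q(1,2) by auto
      \<comment> \<open>Undo the scaling and the shift on the branches of both parts.\<close>
      let ?hs = "map (\<lambda>f t. c t + t ^ m * f t) (fs @ gs)"
      have "\<forall>\<^sub>F t in at 0. M t = mset (map (\<lambda>f. f t) ?hs)"
        using M_M2 fs(3) gs(3)
      proof eventually_elim
        case (elim t)
        have "M2 t = mset (map (\<lambda>f. f t) (fs @ gs))"
          by (subst part) (simp only: elim(2,3), simp)
        then show ?case by (subst elim(1)) (simp add: o_def multiset.map_comp)
      qed
      moreover have "rgerm (\<lambda>t. c t + t ^ m * f t)" if "rgerm f" for f
        unfolding of_real_add of_real_mult of_real_power
        by (intro cgerm_add cgerm_mult cgerm_power cgerm_ident c that)
      then have "\<forall>f\<in>set ?hs. rgerm f" using fs gs by auto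
      ultimately show ?thesis using fs gs Q by (intro exI[of _ ?hs]) auto
    qed
  qed
qed

section \<open>Traces of powers and eigenvalues\<close>

definition mtrace :: "'a::comm_semiring_1 mat \<Rightarrow> 'a" where
  "mtrace A = (\<Sum>i<dim_row A. A $$ (i, i))"

lemma mult_mat_entry:
  assumes "A \<in> carrier_mat n n" "B \<in> carrier_mat n n" "i < n" "j < n"
  shows "(A * B) $$ (i, j) = (\<Sum>l<n. A $$ (i, l) * B $$ (l, j))"
  using assms by (simp add: scalar_prod_def atLeast0LessThan)

lemma mtrace_mult_commute:
  fixes A B :: "'a::comm_semiring_1 mat"
  assumes "A \<in> carrier_mat n n" "B \<in> carrier_mat n n"
  shows "mtrace (A * B) = mtrace (B * A)"
proof -
  have "mtrace (A * B) = (\<Sum>i<n. \<Sum>l<n. A $$ (i, l) * B $$ (l, i))"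
    unfolding mtrace_def using assms by (intro sum.cong mult_mat_entry) auto
  also have "\<dots> = (\<Sum>l<n. \<Sum>i<n. B $$ (l, i) * A $$ (i, l))"
    by (subst sum.swap) (simp add: mult.commute)
  also have "\<dots> = mtrace (B * A)"
    unfolding mtrace_def using assms by (intro sum.cong mult_mat_entry[symmetric]) auto
  finally show ?thesis .
qed

lemma upper_triangular_pow:
  fixes B :: "'a::comm_ring_1 mat"
  assumes B: "B \<in> carrier_mat n n" "upper_triangular B"
  shows "(\<forall>i<n. \<forall>l<i. (B ^\<^sub>m j) $$ (i, l) = 0) \<and> (\<forall>i<n. (B ^\<^sub>m j) $$ (i, i) = (B $$ (i, i)) ^ j)"
proof (induction j)
  case 0
  then show ?case using B by auto
next
  case (Suc j)
  have c: "B ^\<^sub>m j \<in> carrier_mat n n" using B by simp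
  have ut: "B $$ (i, l) = 0" if "l < i" "i < n" for i l using B that by auto
  have "(B ^\<^sub>m Suc j) $$ (i, l) = 0" if "i < n" "l < i" for i l
  proof -
    have "(B ^\<^sub>m Suc j) $$ (i, l) = (\<Sum>m<n. (B ^\<^sub>m j) $$ (i, m) * B $$ (m, l))"
      using mult_mat_entry[OF c B(1), of i l] that by simp
    also have "\<dots> = 0"
    proof (intro sum.neutral ballI)
      fix m assume "m \<in> {..<n}"
      then show "(B ^\<^sub>m j) $$ (i, m) * B $$ (m, l) = 0"
        using Suc ut that by (cases "m < i") auto
    qed
    finally show ?thesis .
  qed
  moreover have "(B ^\<^sub>m Suc j) $$ (i, i) = (B $$ (i, i)) ^ Suc j" if "i < n" for i
  proof -
    have "(B ^\<^sub>m Suc j) $$ (i, i) = (\<Sum>m<n. (B ^\<^sub>m j) $$ (i, m) * B $$ (m, i))"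
      using mult_mat_entry[OF c B(1), of i i] that by simp
    also have "\<dots> = (\<Sum>m<n. if m = i then (B $$ (i, i)) ^ j * B $$ (i, i) else 0)"
    proof (intro sum.cong refl)
      fix m assume m: "m \<in> {..<n}"
      consider "m < i" | "m = i" | "m > i" by linarith
      then show "(B ^\<^sub>m j) $$ (i, m) * B $$ (m, i) = (if m = i then (B $$ (i, i)) ^ j * B $$ (i, i) else 0)"
        by cases (use Suc ut that m in auto)
    qed
    finally show ?thesis using that by (simp add: mult.commute)
  qed
  ultimately show ?case by blast
qed

text \<open>By Schur decomposition the matrix is similar to a triangular one with the roots on its
  diagonal; powers act on that diagonal entrywise, and the trace is invariant under
  similarity.\<close>

lemma psum_proots_char_poly:
  fixes A :: "complex mat"
  assumes A: "A \<in> carrier_mat n n"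
  shows "psum (proots (char_poly A)) j = mtrace (A ^\<^sub>m j)" "size (proots (char_poly A)) = n"
proof -
  obtain es where es: "char_poly A = (\<Prod>a\<leftarrow>es. [:- a, 1:])"
    using char_poly_factorized[OF A] by blast
  obtain B P Q where schur: "schur_decomposition A es = (B, P, Q)"
    by (cases "schur_decomposition A es") auto
  have sim: "similar_mat_wit A B P Q" and ut: "upper_triangular B" and diag: "diag_mat B = es"
    using schur_decomposition[OF A es schur] by auto
  note w = similar_mat_witD2[OF A sim]
  have pc: "B ^\<^sub>m j \<in> carrier_mat n n" using w(5) by simp
  have "proots (char_poly A) = mset es"
    unfolding es using proots_prod_linear[of "mset es"] by (metis mset_map prod_mset_prod_list)
  then have pr: "proots (char_poly A) = mset (map (\<lambda>i. B $$ (i, i)) [0..<n])"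
    using diag w(5) by (simp add: diag_mat_def)
  have "mtrace (A ^\<^sub>m j) = mtrace (P * (B ^\<^sub>m j) * Q)" using similar_mat_wit_pow_id[OF sim] by simp
  also have "\<dots> = mtrace (P * (B ^\<^sub>m j * Q))" using w pc by (simp add: assoc_mult_mat[of _ n n _ n _ n])
  also have "\<dots> = mtrace ((B ^\<^sub>m j * Q) * P)" using w pc by (intro mtrace_mult_commute) auto
  also have "\<dots> = mtrace (B ^\<^sub>m j * (Q * P))" using w pc by (simp add: assoc_mult_mat[of _ n n _ n _ n])
  also have "\<dots> = mtrace (B ^\<^sub>m j)" using w pc by simp
  also have "\<dots> = (\<Sum>i<n. (B $$ (i, i)) ^ j)"
    unfolding mtrace_def using upper_triangular_pow[OF w(5) ut, of j] w(5) by (intro sum.cong) auto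
  also have "\<dots> = psum (proots (char_poly A)) j"
    unfolding pr psum_def
    by (simp add: sum_unfold_sum_mset atLeast0LessThan[symmetric] multiset.map_comp o_def)
  finally show "psum (proots (char_poly A)) j = mtrace (A ^\<^sub>m j)" by simp
  show "size (proots (char_poly A)) = n" unfolding pr by simp
qed

lemma herm_eigenvalue_real:
  assumes "A \<in> herm n" "eigenvector A v k"
  shows "k \<in> \<real>"
proof -
  have A: "A \<in> carrier_mat n n" using assms(1) unfolding herm_def by blast
  have h: "cnj (A $$ (i, j)) = A $$ (j, i)" if "i < n" "j < n" for i j
    using assms(1) that unfolding herm_def by (intro sym[of "A $$ (j, i)"]) blast
  have v: "v \<in> carrier_vec n" "v \<noteq> 0\<^sub>v n" "A *\<^sub>v v = k \<cdot>\<^sub>v v"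
    using assms(2) A by (auto simp: eigenvector_def)
  have row: "(\<Sum>j<n. A $$ (i, j) * v $ j) = k * v $ i" if "i < n" for i
  proof -
    have "(A *\<^sub>v v) $ i = (\<Sum>j<n. A $$ (i, j) * v $ j)"
      using A v(1) that by (subst index_mult_mat_vec) (auto simp add: scalar_prod_def atLeast0LessThan)
    then show ?thesis using v that by simp
  qed
  \<comment> \<open>The Hermitian form of \<open>A\<close> at \<open>v\<close>: it equals its own
    conjugate, and also \<open>k\<close> times the squared norm of \<open>v\<close>.\<close>
  define q where "q = (\<Sum>i<n. cnj (v $ i) * (\<Sum>j<n. A $$ (i, j) * v $ j))"
  define s where "s = (\<Sum>i<n. (norm (v $ i))\<^sup>2)"
  have "q = (\<Sum>i<n. k * of_real ((norm (v $ i))\<^sup>2))"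
    unfolding q_def
  proof (intro sum.cong refl)
    fix i assume "i \<in> {..<n}"
    then show "cnj (v $ i) * (\<Sum>j<n. A $$ (i, j) * v $ j) = k * of_real ((norm (v $ i))\<^sup>2)"
      unfolding complex_norm_square by (subst row) (simp_all add: mult_ac)
  qed
  then have q: "q = k * of_real s" by (simp add: s_def sum_distrib_left)
  have "cnj q = (\<Sum>i<n. \<Sum>j<n. v $ i * (A $$ (j, i) * cnj (v $ j)))"
    unfolding q_def by (simp add: h sum_distrib_left)
  also have "\<dots> = (\<Sum>j<n. \<Sum>i<n. v $ i * (A $$ (j, i) * cnj (v $ j)))" by (rule sum.swap)
  also have "\<dots> = q" unfolding q_def by (simp add: sum_distrib_left mult_ac)
  finally have "cnj k * of_real s = k * of_real s" unfolding q by simp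
  moreover have "s \<noteq> 0"
  proof
    assume "s = 0"
    then have "\<forall>i\<in>{..<n}. (norm (v $ i))\<^sup>2 = 0" unfolding s_def by (subst (asm) sum_nonneg_eq_0_iff) auto
    then have "v = 0\<^sub>v n" using v(1) by (intro eq_vecI) auto
    then show False using v(2) by simp
  qed
  ultimately have "cnj k = k" by simp
  then show ?thesis by (simp add: complex_is_Real_iff complex_eq_iff)
qed

text \<open>Taking real parts in \<open>eigs\<close> loses nothing because the roots are real; hence
  the traces of powers are the power sums of the sorted list.\<close>

lemma eigs_herm:
  assumes "A \<in> herm n"
  shows "length (eigs A) = n" "sorted (eigs A)" "complex_of_real (psum (mset (eigs A)) j) = mtrace (A ^\<^sub>m j)"
proof -
  have A: "A \<in> carrier_mat n n" using assms unfolding herm_def by blast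
  note ps = psum_proots_char_poly[OF A]
  have m: "mset (eigs A) = image_mset Re (proots (char_poly A))" by (simp add: eigs_def)
  then show "length (eigs A) = n" using ps(2) by (metis size_image_mset size_mset)
  show "sorted (eigs A)" by (simp add: eigs_def)
  have "char_poly A \<noteq> 0" using degree_monic_char_poly[OF A] by auto
  then have "z \<in> \<real>" if "z \<in># proots (char_poly A)" for z
    using that herm_eigenvalue_real[OF assms] eigenvalue_root_char_poly[OF A, of z]
    unfolding eigenvalue_def by auto
  then have "image_mset complex_of_real (mset (eigs A)) = proots (char_poly A)"
    unfolding m multiset.map_comp o_def by (subst (2) multiset.map_ident[symmetric], intro image_mset_cong) auto
  then show "complex_of_real (psum (mset (eigs A)) j) = mtrace (A ^\<^sub>m j)"
    using ps(1) by (metis psum_image_of_real)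
qed

section \<open>From real-analytic matrix entries to germs of traces\<close>

lemma real_analytic_on_imp_cgerm:
  assumes "real_analytic_on f S" "0 \<in> S"
  shows "cgerm f" "(f \<longlongrightarrow> f 0) (at 0)"
proof -
  obtain r a where r: "r > 0" and s: "\<And>y. \<bar>y\<bar> < r \<Longrightarrow> (\<lambda>m. a m * complex_of_real (y ^ m)) sums f y"
    using assms unfolding real_analytic_on_def by (metis diff_zero)
  define F where "F z = (\<Sum>m. a m * z ^ m)" for z
  have F: "(\<lambda>m. a m * (z - 0) ^ m) sums F z" if "z \<in> ball 0 r" for z
  proof -
    \<comment> \<open>Convergence is given at real points only; a real \<open>y\<close> strictly
      between \<open>norm z\<close> and \<open>r\<close> carries it to the complex point
      \<open>z\<close>.\<close>
    obtain y where y: "norm z < y" "y < r" using \<open>z \<in> ball 0 r\<close> dense by auto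
    then have "\<bar>y\<bar> < r" using norm_ge_zero[of z] by linarith
    from sums_summable[OF s[OF this]] have "summable (\<lambda>m. a m * complex_of_real y ^ m)" by simp
    then have "summable (\<lambda>m. a m * z ^ m)" by (rule powser_inside) (use y in simp)
    then show ?thesis by (simp add: F_def summable_sums)
  qed
  have eq: "f y = F (of_real y)" if "\<bar>y\<bar> < r" for y
    using s[OF that] by (simp add: F_def sums_iff)
  have "F holomorphic_on ball 0 r" using F by (rule power_series_holomorphic)
  then have an: "F analytic_on {0}" using r unfolding analytic_at_ball by blast
  have "\<forall>\<^sub>F y in nhds 0. dist y 0 < r" using r eventually_nhds_metric by blast
  then have ev: "\<forall>\<^sub>F y in at 0. f y = F (complex_of_real y)"
    by (rule eventually_at_filter[THEN iffD2, OF eventually_mono]) (use eq in simp)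
  show "cgerm f" using an ev by (rule cgermI)
  have "((\<lambda>y. F (complex_of_real y)) \<longlongrightarrow> f 0) (at 0)"
    using analytic_at_0_tendsto[OF an] eq[of 0] r by simp
  then show "(f \<longlongrightarrow> f 0) (at 0)"
    by (rule Lim_transform_eventually) (use ev in eventually_elim, simp)
qed

text \<open>The limit is carried along with the germ, since a germ says nothing about the value at t
  = 0.\<close>

lemma cgerm_mtrace_pow:
  assumes "\<And>i l. i < n \<Longrightarrow> l < n \<Longrightarrow> cgerm (\<lambda>t. H t $$ (i, l)) \<and> ((\<lambda>t. H t $$ (i, l)) \<longlongrightarrow> H 0 $$ (i, l)) (at 0)"
    and H: "\<forall>\<^sub>F t in at 0. H t \<in> carrier_mat n n" and H0: "H 0 \<in> carrier_mat n n"
  shows "cgerm (\<lambda>t. mtrace (H t ^\<^sub>m j))" "((\<lambda>t. mtrace (H t ^\<^sub>m j)) \<longlongrightarrow> mtrace (H 0 ^\<^sub>m j)) (at 0)"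
proof -
  have entry: "cgerm (\<lambda>t. (H t ^\<^sub>m j) $$ (i, l)) \<and> ((\<lambda>t. (H t ^\<^sub>m j) $$ (i, l)) \<longlongrightarrow> (H 0 ^\<^sub>m j) $$ (i, l)) (at 0)"
    if "i < n" "l < n" for i l using that
  proof (induction j arbitrary: i l)
    case 0
    have e: "\<forall>\<^sub>F t in at 0. (H 0 ^\<^sub>m 0) $$ (i, l) = (H t ^\<^sub>m 0) $$ (i, l)"
      using H by eventually_elim (use H0 in auto)
    show ?case
      using cgerm_cong[OF cgerm_const e] Lim_transform_eventually[OF tendsto_const e] by blast
  next
    case (Suc j)
    have e: "\<forall>\<^sub>F t in at 0. (\<Sum>m<n. (H t ^\<^sub>m j) $$ (i, m) * H t $$ (m, l)) = (H t ^\<^sub>m Suc j) $$ (i, l)"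
      using H by eventually_elim (use Suc.prems in \<open>subst pow_mat.simps, subst mult_mat_entry[of _ n], auto\<close>)
    have e0: "(\<Sum>m<n. (H 0 ^\<^sub>m j) $$ (i, m) * H 0 $$ (m, l)) = (H 0 ^\<^sub>m Suc j) $$ (i, l)"
      using H0 Suc.prems by (subst pow_mat.simps, subst mult_mat_entry[of _ n]) auto
    have "cgerm (\<lambda>t. (H t ^\<^sub>m Suc j) $$ (i, l))"
      by (rule cgerm_cong[OF _ e], intro cgerm_sum cgerm_mult) (use assms Suc in auto)
    moreover have "((\<lambda>t. (H t ^\<^sub>m Suc j) $$ (i, l)) \<longlongrightarrow> (H 0 ^\<^sub>m Suc j) $$ (i, l)) (at 0)"
      unfolding e0[symmetric]
      by (rule Lim_transform_eventually[OF _ e], intro tendsto_sum tendsto_mult) (use assms Suc in auto)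
    ultimately show ?case ..
  qed
  have e: "\<forall>\<^sub>F t in at 0. (\<Sum>i<n. (H t ^\<^sub>m j) $$ (i, i)) = mtrace (H t ^\<^sub>m j)"
    using H by eventually_elim (auto simp: mtrace_def)
  have e0: "(\<Sum>i<n. (H 0 ^\<^sub>m j) $$ (i, i)) = mtrace (H 0 ^\<^sub>m j)"
    using H0 by (auto simp: mtrace_def)
  show "cgerm (\<lambda>t. mtrace (H t ^\<^sub>m j))"
    by (rule cgerm_cong[OF _ e], intro cgerm_sum) (use entry in auto)
  show "((\<lambda>t. mtrace (H t ^\<^sub>m j)) \<longlongrightarrow> mtrace (H 0 ^\<^sub>m j)) (at 0)"
    unfolding e0[symmetric]
    by (rule Lim_transform_eventually[OF _ e], intro tendsto_sum) (use entry in auto)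
qed

section \<open>Ordered eigenvalues\<close>

text \<open>Insertion sort for a relation that need not be antisymmetric: it will be applied to
  eventual inequality of functions, where different functions may agree near 0.\<close>

lemma ex_sorted_wrt_total_preorder:
  assumes "\<And>x y. x \<in> set xs \<Longrightarrow> y \<in> set xs \<Longrightarrow> R x y \<or> R y x"
    and "\<And>x y z. R x y \<Longrightarrow> R y z \<Longrightarrow> R x z"
  shows "\<exists>ys. mset ys = mset xs \<and> sorted_wrt R ys"
  using assms(1)
proof (induction xs)
  case (Cons x xs)
  then obtain ys where ys: "mset ys = mset xs" "sorted_wrt R ys" by auto
  let ?zs = "filter (\<lambda>y. \<not> R x y) ys @ x # filter (R x) ys"
  have set: "set ys = set xs" using ys(1) by (metis set_mset_mset)
  have le: "R y x" if "y \<in> set ys" "\<not> R x y" for y using Cons.prems that set by auto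
  have "mset ?zs = mset (x # xs)"
    using ys(1) multiset_partition[of "mset ys" "R x"] by simp
  moreover have "sorted_wrt R ?zs"
    using ys(2) le assms(2) by (auto simp: sorted_wrt_append sorted_wrt_filter)
  ultimately show ?case by blast
qed simp

lemma at_0_imp_at_right_0: "eventually P (at (0::real)) \<Longrightarrow> eventually P (at_right 0)"
  by (simp add: eventually_at_split)

text \<open>The leading coefficient of \<open>g - f\<close> decides. One side of 0 has to be chosen,
  since for an odd leading exponent the sign changes at 0.\<close>

lemma rgerm_comparable:
  assumes "rgerm f" "rgerm g"
  shows "(\<forall>\<^sub>F t in at_right 0. f t \<le> g t) \<or> (\<forall>\<^sub>F t in at_right 0. g t \<le> f t)"
proof -
  have "rgerm (\<lambda>t. g t - f t)" using cgerm_diff[OF assms(2,1)] by simp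
  from rgerm_factor[OF this] show ?thesis
  proof (elim disjE exE conjE)
    assume "\<forall>\<^sub>F t in at 0. g t - f t = 0"
    then have "\<forall>\<^sub>F t in at_right 0. g t - f t = 0" by (rule at_0_imp_at_right_0)
    then have "\<forall>\<^sub>F t in at_right 0. f t \<le> g t" by eventually_elim simp
    then show ?thesis ..
  next
    fix m h L assume h: "L \<noteq> 0" "(h \<longlongrightarrow> L) (at 0)" "\<forall>\<^sub>F t in at 0. g t - f t = t ^ m * h t"
    have pos: "\<forall>\<^sub>F t in at_right 0. t > (0::real)" by (rule eventually_at_right_less)
    show ?thesis
    proof (cases "L > 0")
      case True
      have "\<forall>\<^sub>F t in at_right 0. f t \<le> g t"
        using at_0_imp_at_right_0[OF order_tendstoD(1)[OF h(2) True]] at_0_imp_at_right_0[OF h(3)] pos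
      proof eventually_elim
        case (elim t)
        then have "0 \<le> t ^ m * h t" by simp
        then show ?case using elim by linarith
      qed
      then show ?thesis ..
    next
      case False
      then have "L < 0" using h(1) by simp
      have "\<forall>\<^sub>F t in at_right 0. g t \<le> f t"
        using at_0_imp_at_right_0[OF order_tendstoD(2)[OF h(2) \<open>L < 0\<close>]] at_0_imp_at_right_0[OF h(3)] pos
      proof eventually_elim
        case (elim t)
        then have "t ^ m * h t \<le> 0" by (simp add: mult_le_0_iff)
        then show ?case using elim by linarith
      qed
      then show ?thesis ..
    qed
  qed
qed

theorem ordered_eigenvalues_analytic:
  fixes H :: "real \<Rightarrow> complex mat"
  assumes H: "\<forall>t\<in>{-r<..<r}. H t \<in> herm n" and r: "r > 0"
    and an: "\<forall>i<n. \<forall>j<n. real_analytic_on (\<lambda>t. H t $$ (i,j)) {-r<..<r}"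
  shows "\<exists>h. \<forall>i<n. rgerm (h i) \<and> (h i \<longlongrightarrow> eigs (H 0) ! i) (at 0) \<and> (\<forall>\<^sub>F t in at_right 0. eigs (H t) ! i = h i t)"
proof -
  have "\<forall>\<^sub>F t in at 0. t \<in> {-r<..<r}"
    by (rule eventually_at_in_open') (use r in auto)
  then have evH: "\<forall>\<^sub>F t in at 0. H t \<in> herm n" by eventually_elim (use H in blast)
  then have evc: "\<forall>\<^sub>F t in at 0. H t \<in> carrier_mat n n" by eventually_elim (simp add: herm_def)
  have H0: "H 0 \<in> herm n" using H r by simp
  then have c0: "H 0 \<in> carrier_mat n n" by (simp add: herm_def)
  define M where "M t = mset (eigs (H t))" for t
  have ps: "complex_of_real (psum (M t) j) = mtrace (H t ^\<^sub>m j)" if "H t \<in> herm n" for t j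
    using eigs_herm(3)[OF that] by (simp add: M_def)
  have entry: "cgerm (\<lambda>t. H t $$ (i, l)) \<and> ((\<lambda>t. H t $$ (i, l)) \<longlongrightarrow> H 0 $$ (i, l)) (at 0)" if "i < n" "l < n" for i l
    using real_analytic_on_imp_cgerm[of "\<lambda>t. H t $$ (i, l)" "{-r<..<r}"] an that r by auto
  note tr = cgerm_mtrace_pow[OF entry evc c0]
  have evps: "\<forall>\<^sub>F t in at 0. mtrace (H t ^\<^sub>m j) = complex_of_real (psum (M t) j)" for j
    using evH by eventually_elim (simp add: ps)
  have germ: "rgerm (\<lambda>t. psum (M t) j)" for j
    using tr(1) evps by (rule cgerm_cong)
  have "((\<lambda>t. complex_of_real (psum (M t) j)) \<longlongrightarrow> complex_of_real (psum (M 0) j)) (at 0)" for j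
    using Lim_transform_eventually[OF tr(2) evps] by (simp add: ps[OF H0])
  then have lim0: "((\<lambda>t. psum (M t) j) \<longlongrightarrow> psum (M 0) j) (at 0)" for j
    by (simp add: tendsto_of_real_iff)
  have "\<forall>\<^sub>F t in at 0. size (M t) = n" using evH by eventually_elim (simp add: M_def eigs_herm)
  from analytic_root_functions[OF germ this] obtain fs where fs: "length fs = n" "\<forall>f\<in>set fs. rgerm f"
    "\<forall>\<^sub>F t in at 0. M t = mset (map (\<lambda>f. f t) fs)" by blast
  define R where "R f g \<longleftrightarrow> (\<forall>\<^sub>F t in at_right 0. f t \<le> g t)" for f g :: "real \<Rightarrow> real"
  have trans: "R f h" if "R f g" "R g h" for f g h
    using that unfolding R_def by eventually_elim simp
  have "\<exists>hs. mset hs = mset fs \<and> sorted_wrt R hs"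
    by (rule ex_sorted_wrt_total_preorder[OF _ trans]) (use fs(2) rgerm_comparable in \<open>auto simp: R_def\<close>)
  then obtain hs where hs: "mset hs = mset fs" "sorted_wrt R hs" by blast
  have len: "length hs = n" using hs(1) fs(1) by (metis size_mset)
  have germs: "rgerm (hs ! i)" if "i < n" for i
    using fs(2) hs(1) that len by (metis nth_mem set_mset_mset)
  have Mhs: "\<forall>\<^sub>F t in at 0. M t = mset (map (\<lambda>h. h t) hs)"
    using fs(3) by eventually_elim (simp add: hs(1))
  \<comment> \<open>There are finitely many pairs, so one right neighbourhood of 0 orders all
    branches simultaneously.\<close>
  have "\<forall>\<^sub>F t in at_right 0. \<forall>p\<in>{(i, j). i < j \<and> j < n}. (hs ! fst p) t \<le> (hs ! snd p) t"
  proof (rule eventually_ball_finite)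
    have "{(i, j). i < j \<and> j < n} \<subseteq> {..<n} \<times> {..<n}" by auto
    then show "finite {(i, j). i < j \<and> j < n}" by (rule finite_subset) simp
  qed (use hs(2) len in \<open>auto simp: sorted_wrt_iff_nth_less R_def\<close>)
  then have sorted: "\<forall>\<^sub>F t in at_right 0. eigs (H t) = map (\<lambda>h. h t) hs"
    using at_0_imp_at_right_0[OF Mhs] at_0_imp_at_right_0[OF evH]
  proof eventually_elim
    case (elim t)
    have "sorted (map (\<lambda>h. h t) hs)"
      using elim(1) len by (auto simp: sorted_wrt_iff_nth_less)
    then show ?case
      using elim(2) eigs_herm(2)[OF elim(3)] unfolding M_def by (metis properties_for_sort sorted_sort_id)
  qed
  have "\<exists>l. (hs ! i \<longlongrightarrow> l) (at 0)" if "i < n" for i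
    using rgerm_has_limit[OF germs[OF that]] by blast
  then obtain l where l: "\<And>i. i < n \<Longrightarrow> (hs ! i \<longlongrightarrow> l i) (at 0)" by metis
  let ?ls = "map l [0..<n]"
  \<comment> \<open>Continuity of the spectrum at 0: the limits have the power sums of
    \<open>M 0\<close>, hence are its elements, and as they are sorted they match index by
    index.\<close>
  have "psum (mset ?ls) j = psum (M 0) j" for j
  proof (rule tendsto_unique[OF _ _ lim0])
    have e: "\<forall>\<^sub>F t in at 0. (\<Sum>i<n. (hs ! i) t ^ j) = psum (M t) j"
      using Mhs
    proof eventually_elim
      case (elim t)
      have "(\<Sum>i<n. (hs ! i) t ^ j) = (\<Sum>h\<leftarrow>hs. h t ^ j)"
        unfolding sum_list_sum_nth using len by (simp add: atLeast0LessThan)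
      also have "\<dots> = psum (mset (map (\<lambda>h. h t) hs)) j"
        unfolding psum_def by (simp add: multiset.map_comp o_def flip: sum_mset_sum_list)
      finally show ?case using elim by simp
    qed
    have "psum (mset ?ls) j = (\<Sum>i<n. l i ^ j)"
      unfolding psum_def
      by (simp add: sum_unfold_sum_mset atLeast0LessThan[symmetric] multiset.map_comp o_def)
    moreover have "((\<lambda>t. psum (M t) j) \<longlongrightarrow> (\<Sum>i<n. l i ^ j)) (at 0)"
      by (rule Lim_transform_eventually[OF _ e]) (intro tendsto_sum tendsto_power l, simp)
    ultimately show "((\<lambda>t. psum (M t) j) \<longlongrightarrow> psum (mset ?ls) j) (at 0)" by simp
  qed simp
  then have "mset ?ls = M 0" by (rule multiset_eqI_psum)
  moreover have "sorted ?ls"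
  proof -
    have "l i \<le> l j" if "i < j" "j < n" for i j
    proof (rule tendsto_le)
      show "(hs ! j \<longlongrightarrow> l j) (at_right 0)" "(hs ! i \<longlongrightarrow> l i) (at_right 0)"
        using l[of i] l[of j] that by (auto simp: filterlim_at_split)
      show "\<forall>\<^sub>F t in at_right 0. (hs ! i) t \<le> (hs ! j) t"
        using hs(2) len that by (auto simp: sorted_wrt_iff_nth_less R_def)
    qed simp
    then show ?thesis by (auto simp: sorted_wrt_iff_nth_less)
  qed
  ultimately have "eigs (H 0) = ?ls"
    using eigs_herm(2)[OF H0] unfolding M_def by (metis properties_for_sort sorted_sort_id)
  then have "(hs ! i \<longlongrightarrow> eigs (H 0) ! i) (at 0)" if "i < n" for i using l that by simp
  moreover have "\<forall>\<^sub>F t in at_right 0. eigs (H t) ! i = (hs ! i) t" if "i < n" for i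
    using sorted by eventually_elim (use that len in simp)
  ultimately show ?thesis using germs by (intro exI[of _ "\<lambda>i. hs ! i"]) blast
qed

section \<open>Power series and orders of vanishing\<close>

text \<open>The series comes from \<open>f\<close>, and \<open>g\<close> agrees with
  \<open>f\<close> only for t > 0; the limit hypothesis makes the series correct at t = 0
  too.\<close>

lemma rgerm_imp_ps_on:
  assumes f: "rgerm f" "(f \<longlongrightarrow> g 0) (at 0)" and g: "\<forall>\<^sub>F t in at_right 0. g t = f t"
  shows "\<exists>eps>0. \<exists>a. ps_on g eps a"
proof -
  obtain F where F: "F analytic_on {0}" "\<forall>\<^sub>F t in at 0. complex_of_real (f t) = F (complex_of_real t)"
    using f(1) unfolding cgerm_def by blast
  have F0: "F 0 = of_real (g 0)"
    using rgerm_tendsto[OF F] tendsto_unique[OF _ f(2)] by force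
  obtain r where r: "r > 0" "F holomorphic_on ball 0 r"
    using F(1) unfolding analytic_at_ball by blast
  have "\<forall>\<^sub>F t in at_right 0. complex_of_real (g t) = F (complex_of_real t)"
    using at_0_imp_at_right_0[OF F(2)] g by eventually_elim simp
  then obtain b where b: "b > 0" "\<And>t. 0 < t \<Longrightarrow> t < b \<Longrightarrow> complex_of_real (g t) = F (complex_of_real t)"
    unfolding eventually_at_right_field by blast
  \<comment> \<open>For real t the real part of the series is the series of real parts, so the
    Taylor coefficients need not be proved real.\<close>
  define a where "a m = Re ((deriv ^^ m) F 0 / fact m)" for m
  have "ps_on g (min r b) a"
    unfolding ps_on_def
  proof
    fix t assume t: "t \<in> {0..<min r b}"
    have "complex_of_real (g t) = F (of_real t)" using b F0 t by (cases "t = 0") auto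
    then have "(\<lambda>m. (deriv ^^ m) F 0 / fact m * (of_real t - 0) ^ m) sums complex_of_real (g t)"
      using holomorphic_power_series[OF r(2), of "of_real t"] t by simp
    from sums_Re[OF this] have "(\<lambda>m. Re ((deriv ^^ m) F 0 / fact m * (of_real t - 0) ^ m)) sums g t"
      by (simp only: Re_complex_of_real)
    moreover have "Re (x * (of_real t - 0) ^ m) = Re x * t ^ m" for x m
      by (simp flip: of_real_power)
    ultimately show "(\<lambda>m. a m * t ^ m) sums g t" by (simp only: a_def)
  qed
  moreover have "min r b > 0" using r b by simp
  ultimately show ?thesis by blast
qed

lemma ps_on_subset: "ps_on g eps a \<Longrightarrow> eps' \<le> eps \<Longrightarrow> ps_on g eps' a"
  unfolding ps_on_def by auto

lemma ps_on_diff: "ps_on f eps a \<Longrightarrow> ps_on g eps b \<Longrightarrow> ps_on (\<lambda>t. f t - g t) eps (\<lambda>m. a m - b m)"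
  unfolding ps_on_def by (auto simp: left_diff_distrib intro: sums_diff)

lemma ps_on_divide: "ps_on f eps a \<Longrightarrow> ps_on (\<lambda>t. f t / c) eps (\<lambda>m. a m / c)"
  unfolding ps_on_def using sums_divide[of _ _ c] by (auto simp: field_simps)

lemma ps_on_sum:
  "(\<And>i. i \<in> I \<Longrightarrow> ps_on (f i) eps (a i)) \<Longrightarrow> ps_on (\<lambda>t. \<Sum>i\<in>I. f i t) eps (\<lambda>m. \<Sum>i\<in>I. a i m)"
  unfolding ps_on_def by (auto simp: sum_distrib_right intro!: sums_sum)

section \<open>Orders of vanishing as growth rates\<close>

definition vanishes_to_order :: "nat \<Rightarrow> (real \<Rightarrow> real) \<Rightarrow> bool" where
  "vanishes_to_order m g \<longleftrightarrow> (\<exists>C. \<forall>\<^sub>F t in at_right 0. \<bar>g t\<bar> \<le> C * t ^ m)"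

lemma ps_on_vanishes_to_order_iff:
  assumes "ps_on g eps a" "eps > 0"
  shows "vanishes_to_order m g \<longleftrightarrow> (\<forall>l<m. a l = 0)"
proof -
  \<comment> \<open>\<open>ps_on\<close> gives convergence only for t >= 0; convergence at the point
    \<open>t0\<close> extends to all |t| < t0, so that limits at 0 may be taken from both
    sides.\<close>
  define t0 where "t0 = eps / 2"
  have t0: "0 < t0" "t0 < eps" using assms by (auto simp: t0_def)
  have sm: "summable (\<lambda>i. a i * t ^ i)" if "\<bar>t\<bar> < t0" for t
  proof (rule powser_inside)
    show "summable (\<lambda>i. a i * t0 ^ i)" using assms(1) t0 unfolding ps_on_def by (auto dest: sums_summable)
  qed (use that in simp)
  have tail: "\<exists>h. (h \<longlongrightarrow> a p) (at 0) \<and> (\<forall>\<^sub>F t in at_right 0. g t = t ^ p * h t)" if p: "\<forall>l<p. a l = 0" for p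
  proof -
    define h where "h t = (\<Sum>i. a (i + p) * t ^ i)" for t
    have hs: "(\<lambda>i. a (i + p) * t ^ i) sums h t" if "norm t < t0" for t
    proof (cases "t = 0")
      case True
      then show ?thesis using powser_sums_zero[of "\<lambda>i. a (i + p)"] by (simp add: h_def sums_iff)
    next
      case False
      have "summable (\<lambda>i. a (i + p) * t ^ (i + p))" using sm[of t] that by (subst summable_iff_shift) simp
      then have "summable (\<lambda>i. t ^ p * (a (i + p) * t ^ i))" by (simp add: power_add mult_ac)
      then have "summable (\<lambda>i. a (i + p) * t ^ i)" using False by (subst (asm) summable_cmult_iff) simp
      then show ?thesis by (simp add: h_def summable_sums)
    qed
    have "(h \<longlongrightarrow> a (0 + p)) (at 0)" by (rule powser_limit_0[OF t0(1) hs])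
    moreover have "\<forall>\<^sub>F t in at_right 0. g t = t ^ p * h t"
      unfolding eventually_at_right_field
    proof (intro exI[of _ t0] conjI allI impI)
      fix t :: real assume t: "0 < t" "t < t0"
      have "(\<lambda>i. a i * t ^ i) sums g t" using assms(1) t t0 unfolding ps_on_def by auto
      moreover have "(\<Sum>i<p. a i * t ^ i) = 0" using p by simp
      ultimately have "(\<lambda>i. a (i + p) * t ^ (i + p)) sums g t"
        using sums_split_initial_segment[of "\<lambda>i. a i * t ^ i" "g t" p] by simp
      moreover have "(\<lambda>i. t ^ p * (a (i + p) * t ^ i)) sums (t ^ p * h t)"
        using hs[of t] t by (intro sums_mult) simp
      then have "(\<lambda>i. a (i + p) * t ^ (i + p)) sums (t ^ p * h t)" by (simp add: power_add mult_ac)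
      ultimately show "g t = t ^ p * h t" by (rule sums_unique2)
    qed (use t0 in simp)
    ultimately show ?thesis by auto
  qed
  have pos: "\<forall>\<^sub>F t in at_right 0. t > (0::real)" by (rule eventually_at_right_less)
  show ?thesis
  proof
    assume "\<forall>l<m. a l = 0"
    then obtain h where h: "(h \<longlongrightarrow> a m) (at 0)" "\<forall>\<^sub>F t in at_right 0. g t = t ^ m * h t" using tail by blast
    have "\<forall>\<^sub>F t in at 0. \<bar>h t\<bar> < \<bar>a m\<bar> + 1"
      by (rule order_tendstoD[OF tendsto_rabs[OF h(1)]]) simp
    from at_0_imp_at_right_0[OF this] h(2) pos have "\<forall>\<^sub>F t in at_right 0. \<bar>g t\<bar> \<le> (\<bar>a m\<bar> + 1) * t ^ m"
    proof eventually_elim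
      case (elim t)
      then have "\<bar>h t\<bar> * t ^ m \<le> (\<bar>a m\<bar> + 1) * t ^ m" by (intro mult_right_mono) auto
      then show ?case using elim by (simp add: abs_mult mult.commute)
    qed
    then show "vanishes_to_order m g" unfolding vanishes_to_order_def by blast
  next
    assume "vanishes_to_order m g"
    then obtain C where C: "\<forall>\<^sub>F t in at_right 0. \<bar>g t\<bar> \<le> C * t ^ m" unfolding vanishes_to_order_def by blast
    show "\<forall>l<m. a l = 0"
    proof (intro allI impI)
      fix l assume "l < m"
      then show "a l = 0"
      proof (induction l rule: less_induct)
        case (less l)
        then obtain h where h: "(h \<longlongrightarrow> a l) (at 0)" "\<forall>\<^sub>F t in at_right 0. g t = t ^ l * h t"
          using tail[of l] by auto
        \<comment> \<open>The earlier coefficients vanish, so \<open>h\<close> tends to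
          \<open>a l\<close>; the bound with positive exponent \<open>m - l\<close> forces this
          limit to be 0.\<close>
        have "\<forall>\<^sub>F t in at_right 0. \<bar>h t\<bar> \<le> C * t ^ (m - l)"
          using C h(2) pos
        proof eventually_elim
          case (elim t)
          have "t ^ m = t ^ l * t ^ (m - l)" using less.prems by (simp flip: power_add)
          then have "t ^ l * \<bar>h t\<bar> \<le> t ^ l * (C * t ^ (m - l))"
            using elim by (simp add: abs_mult mult_ac)
          then show ?case using elim(3) by simp
        qed
        moreover have "((\<lambda>t. C * t ^ (m - l)) \<longlongrightarrow> C * 0 ^ (m - l)) (at_right (0::real))"
          by (intro tendsto_intros)
        moreover have "((\<lambda>t. \<bar>h t\<bar>) \<longlongrightarrow> \<bar>a l\<bar>) (at_right 0)"
          using h(1) by (intro tendsto_rabs) (simp add: filterlim_at_split)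
        ultimately have "\<bar>a l\<bar> \<le> C * 0 ^ (m - l)" by (intro tendsto_le[of "at_right (0::real)"]) auto
        then show ?case using less.prems zero_power[of "m - l", where 'a = real] by simp
      qed
    qed
  qed
qed

text \<open>The series selected by \<open>SOME\<close> is one that represents \<open>g\<close>, and
  the growth criterion holds for every such series, so the choice does not matter.\<close>

lemma enat_le_ord0_iff:
  assumes "\<exists>eps>0. \<exists>a. ps_on g eps a"
  shows "enat m \<le> ord0 g \<longleftrightarrow> vanishes_to_order m g"
proof -
  define a where "a = (SOME a. \<exists>eps>0. ps_on g eps a)"
  have "\<exists>a. \<exists>eps>0. ps_on g eps a" using assms by blast
  from someI_ex[OF this] have "\<exists>eps>0. ps_on g eps a" unfolding a_def .
  then obtain eps where a: "eps > 0" "ps_on g eps a" by blast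
  have o: "ord0 g = (if \<forall>m. a m = 0 then \<infinity> else enat (LEAST m. a m \<noteq> 0))"
    unfolding ord0_def a_def Let_def ..
  have "enat m \<le> ord0 g \<longleftrightarrow> (\<forall>l<m. a l = 0)"
  proof (cases "\<forall>m. a m = 0")
    case False
    then obtain q where q: "a q \<noteq> 0" by blast
    have "m \<le> (LEAST m. a m \<noteq> 0) \<longleftrightarrow> (\<forall>l<m. a l = 0)"
    proof
      assume "m \<le> (LEAST m. a m \<noteq> 0)"
      then show "\<forall>l<m. a l = 0" using not_less_Least[of _ "\<lambda>m. a m \<noteq> 0"] less_le_trans by blast
    next
      assume "\<forall>l<m. a l = 0"
      then have "\<not> (LEAST m. a m \<noteq> 0) < m" using LeastI[of "\<lambda>m. a m \<noteq> 0", OF q] by blast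
      then show "m \<le> (LEAST m. a m \<noteq> 0)" by (rule leI)
    qed
    then show ?thesis using False by (simp add: o)
  qed (simp add: o)
  then show ?thesis using ps_on_vanishes_to_order_iff[OF a(2,1)] by simp
qed

lemma enat_eqI_le:
  assumes "\<And>m. enat m \<le> a \<longleftrightarrow> enat m \<le> b" shows "a = b"
proof -
  have "x \<le> y" if "\<And>m. enat m \<le> x \<Longrightarrow> enat m \<le> y" for x y :: enat
  proof (cases x)
    case infinity
    then have "enat m \<le> y" for m using that by simp
    from this[of "Suc (the_enat y)"] have "y = \<infinity>" by (cases y) auto
    then show ?thesis by simp
  qed (use that in auto)
  then show ?thesis using assms by (intro antisym) blast+
qed

lemma vanishes_to_order_mono:
  assumes "vanishes_to_order m f" "\<forall>\<^sub>F t in at_right 0. \<bar>g t\<bar> \<le> c * \<bar>f t\<bar>" "c \<ge> 0"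
  shows "vanishes_to_order m g"
proof -
  obtain C where "\<forall>\<^sub>F t in at_right 0. \<bar>f t\<bar> \<le> C * t ^ m" using assms(1) unfolding vanishes_to_order_def by blast
  with assms(2) have "\<forall>\<^sub>F t in at_right 0. \<bar>g t\<bar> \<le> (c * C) * t ^ m"
  proof eventually_elim
    case (elim t)
    then show ?case using mult_left_mono[OF elim(2) assms(3)] by simp
  qed
  then show ?thesis unfolding vanishes_to_order_def by blast
qed

lemma vanishes_to_order_sum:
  assumes "\<And>i. i \<in> I \<Longrightarrow> vanishes_to_order m (f i)" "finite I"
  shows "vanishes_to_order m (\<lambda>t. \<Sum>i\<in>I. f i t)"
proof -
  obtain C where C: "\<And>i. i \<in> I \<Longrightarrow> \<forall>\<^sub>F t in at_right 0. \<bar>f i t\<bar> \<le> C i * t ^ m"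
    using assms(1) unfolding vanishes_to_order_def by metis
  have "\<forall>\<^sub>F t in at_right 0. \<forall>i\<in>I. \<bar>f i t\<bar> \<le> C i * t ^ m"
    by (intro eventually_ball_finite assms ballI C)
  then have "\<forall>\<^sub>F t in at_right 0. \<bar>\<Sum>i\<in>I. f i t\<bar> \<le> (\<Sum>i\<in>I. C i) * t ^ m"
  proof eventually_elim
    case (elim t)
    have "\<bar>\<Sum>i\<in>I. f i t\<bar> \<le> (\<Sum>i\<in>I. C i * t ^ m)"
      using elim by (intro order_trans[OF sum_abs] sum_mono) auto
    then show ?case by (simp add: sum_distrib_right)
  qed
  then show ?thesis unfolding vanishes_to_order_def by blast
qed

section \<open>Comparison of the orders\<close>

lemma vanishes_to_order_diff:
  assumes "vanishes_to_order m f" "vanishes_to_order m g"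
  shows "vanishes_to_order m (\<lambda>t. f t - g t)"
proof -
  obtain C C' where "\<forall>\<^sub>F t in at_right 0. \<bar>f t\<bar> \<le> C * t ^ m" "\<forall>\<^sub>F t in at_right 0. \<bar>g t\<bar> \<le> C' * t ^ m"
    using assms unfolding vanishes_to_order_def by blast
  then have "\<forall>\<^sub>F t in at_right 0. \<bar>f t - g t\<bar> \<le> (C + C') * t ^ m"
    by eventually_elim (simp add: distrib_right)
  then show ?thesis unfolding vanishes_to_order_def by blast
qed

text \<open>The square root of (t^p)^2 g is |t|^p sqrt g, which is a germ only after the absolute
  value is dropped, that is, on t > 0.\<close>

lemma rgerm_sqrt_at_right:
  assumes f: "rgerm f" "\<forall>\<^sub>F t in at 0. f t \<ge> 0" "(f \<longlongrightarrow> l) (at 0)"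
  shows "\<exists>g. rgerm g \<and> (g \<longlongrightarrow> sqrt l) (at 0) \<and> (\<forall>\<^sub>F t in at_right 0. sqrt (f t) = g t)"
  using rgerm_factor_nonneg[OF f(1,2)]
proof (elim disjE exE conjE)
  assume z: "\<forall>\<^sub>F t in at 0. f t = 0"
  then have "l = 0" using tendsto_unique[OF _ f(3) tendsto_eventually] by simp
  moreover have "\<forall>\<^sub>F t in at_right 0. sqrt (f t) = 0"
    using at_0_imp_at_right_0[OF z] by eventually_elim simp
  ultimately show ?thesis by (intro exI[of _ "\<lambda>t. 0"]) simp
next
  fix p g L assume g: "rgerm g" "L > 0" "(g \<longlongrightarrow> L) (at 0)" "\<forall>\<^sub>F t in at 0. f t = (t ^ p)\<^sup>2 * g t"
  \<comment> \<open>\<open>0 ^ p\<close> is 1 for p = 0 and 0 otherwise, which covers a positive and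
    a zero limit in one formula.\<close>
  have "((\<lambda>t. (t ^ p)\<^sup>2 * g t) \<longlongrightarrow> (0 ^ p)\<^sup>2 * L) (at 0)" by (intro tendsto_intros g)
  moreover have "((\<lambda>t. (t ^ p)\<^sup>2 * g t) \<longlongrightarrow> l) (at 0)" using Lim_transform_eventually[OF f(3) g(4)] .
  ultimately have l: "l = (0 ^ p)\<^sup>2 * L" by (intro tendsto_unique[of "at (0::real)"]) auto
  have "((\<lambda>t. t ^ p * sqrt (g t)) \<longlongrightarrow> 0 ^ p * sqrt L) (at 0)" by (intro tendsto_intros g)
  moreover have "sqrt l = 0 ^ p * sqrt L" by (cases p) (simp_all add: l)
  moreover have "rgerm (\<lambda>t. t ^ p * sqrt (g t))"
    unfolding of_real_mult of_real_power by (intro cgerm_mult cgerm_power cgerm_ident rgerm_sqrt[OF g(1,3,2)])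
  moreover have "\<forall>\<^sub>F t in at_right 0. sqrt (f t) = t ^ p * sqrt (g t)"
    using at_0_imp_at_right_0[OF g(4)] eventually_at_right_less
    by eventually_elim (simp add: real_sqrt_mult)
  ultimately show ?thesis by (intro exI[of _ "\<lambda>t. t ^ p * sqrt (g t)"]) simp
qed

section \<open>Inequalities between \<open>D\<close>, the gaps and the deviations\<close>

text \<open>The mean lies between the extreme eigenvalues, so no deviation exceeds the spread, and
  \<open>D\<close> is a quadratic mean of deviations.\<close>

lemma D_le_spread:
  assumes "k > 0" "\<And>j. 1 \<le> j \<Longrightarrow> j \<le> k \<Longrightarrow> lam A 1 \<le> lam A j \<and> lam A j \<le> lam A k"
  shows "\<bar>D k A\<bar> \<le> \<bar>lam A 1 - lam A k\<bar>"
proof -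
  have "(\<Sum>j=1..k. lam A 1) \<le> (\<Sum>j=1..k. lam A j)" "(\<Sum>j=1..k. lam A j) \<le> (\<Sum>j=1..k. lam A k)"
    by (rule sum_mono; use assms(2) in auto)+
  then have mean: "lam A 1 \<le> lam_mean k A" "lam_mean k A \<le> lam A k"
    using assms(1) by (auto simp: lam_mean_def field_simps)
  have "(\<Sum>j=1..k. (lam A j - lam_mean k A)\<^sup>2) \<le> (\<Sum>j=1..k. (lam A 1 - lam A k)\<^sup>2)"
  proof (rule sum_mono)
    fix j assume "j \<in> {1..k}"
    then have "\<bar>lam A j - lam_mean k A\<bar> \<le> \<bar>lam A 1 - lam A k\<bar>" using assms(2)[of j] mean by auto
    then show "(lam A j - lam_mean k A)\<^sup>2 \<le> (lam A 1 - lam A k)\<^sup>2" by (simp add: abs_le_square_iff)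
  qed
  then have "(\<Sum>j=1..k. (lam A j - lam_mean k A)\<^sup>2) / k \<le> (lam A 1 - lam A k)\<^sup>2"
    using assms(1) by (simp add: field_simps)
  from real_sqrt_le_mono[OF this] have "D k A \<le> \<bar>lam A 1 - lam A k\<bar>" by (simp add: D_def)
  moreover have "D k A \<ge> 0" by (simp add: D_def sum_nonneg)
  ultimately show ?thesis by simp
qed

text \<open>One square is at most the sum of all \<open>k\<close> squares, which is k D^2; hence the
  factor \<open>sqrt k\<close>.\<close>

lemma deviation_le_D:
  assumes "1 \<le> i" "i \<le> k"
  shows "\<bar>lam A i - lam_mean k A\<bar> \<le> sqrt k * \<bar>D k A\<bar>"
proof -
  have "(lam A i - lam_mean k A)\<^sup>2 \<le> (\<Sum>j=1..k. (lam A j - lam_mean k A)\<^sup>2)"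
    using assms by (intro member_le_sum) auto
  also have "\<dots> = (sqrt k * \<bar>D k A\<bar>)\<^sup>2"
    using assms by (simp add: D_def power_mult_distrib sum_nonneg)
  finally have "\<bar>lam A i - lam_mean k A\<bar> \<le> \<bar>sqrt k * \<bar>D k A\<bar>\<bar>" by (simp only: abs_le_square_iff)
  then show ?thesis by (simp add: abs_mult)
qed

theorem mainTheorem6:
  fixes n k :: nat and eps0 :: real and H :: "real \<Rightarrow> complex mat"
  assumes "2 \<le> k" and "k \<le> n - 1"
    and "eps0 > 0"
    and "\<forall>t\<in>{-eps0<..<eps0}. H t \<in> herm n"
    and "\<forall>i<n. \<forall>j<n. real_analytic_on (\<lambda>t. H t $$ (i,j)) {-eps0<..<eps0}"
    and "H 0 \<in> Sigma n k"
  shows "\<exists>eps>0.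
     (\<exists>a. ps_on (\<lambda>t. D k (H t)) eps a) \<and>
     (\<forall>i j. 1 \<le> i \<and> i < j \<and> j \<le> k \<longrightarrow>
        (\<exists>a. ps_on (\<lambda>t. lam (H t) i - lam (H t) j) eps a)) \<and>
     (\<forall>i. 1 \<le> i \<and> i \<le> k \<longrightarrow>
        (\<exists>a. ps_on (\<lambda>t. lam (H t) i - lam_mean k (H t)) eps a)) \<and>
     ord0 (\<lambda>t. D k (H t)) =
       Min {ord0 (\<lambda>t. lam (H t) i - lam (H t) j) | i j. 1 \<le> i \<and> i < j \<and> j \<le> k} \<and>
     Min {ord0 (\<lambda>t. lam (H t) i - lam (H t) j) | i j. 1 \<le> i \<and> i < j \<and> j \<le> k} =
       Min {ord0 (\<lambda>t. lam (H t) i - lam (H t) (i+1)) | i. 1 \<le> i \<and> i \<le> k - 1} \<and>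
     Min {ord0 (\<lambda>t. lam (H t) i - lam (H t) (i+1)) | i. 1 \<le> i \<and> i \<le> k - 1} =
       ord0 (\<lambda>t. lam (H t) 1 - lam (H t) k) \<and>
     ord0 (\<lambda>t. lam (H t) 1 - lam (H t) k) =
       Min {ord0 (\<lambda>t. lam (H t) i - lam_mean k (H t)) | i. 1 \<le> i \<and> i \<le> k}"
proof -
  \<comment> \<open>\<open>n - 1\<close> is truncated subtraction; \<open>2 \<le> k\<close> rules
    out n = 0.\<close>
  have kn: "k < n" using assms(1,2) by linarith
  obtain h where h: "\<And>i. i < n \<Longrightarrow> rgerm (h i)" "\<And>i. i < n \<Longrightarrow> (h i \<longlongrightarrow> eigs (H 0) ! i) (at 0)"
    "\<And>i. i < n \<Longrightarrow> \<forall>\<^sub>F t in at_right 0. eigs (H t) ! i = h i t"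
    using ordered_eigenvalues_analytic[OF assms(4,3,5)] by blast
  \<comment> \<open>\<open>lam\<close> counts from 1, list positions from 0.\<close>
  define \<mu> where "\<mu> j = h (j - 1)" for j
  have \<mu>: "rgerm (\<mu> j)" "(\<mu> j \<longlongrightarrow> lam (H 0) j) (at 0)" "\<forall>\<^sub>F t in at_right 0. lam (H t) j = \<mu> j t"
    if "j \<in> {1..k}" for j
    using h[of "j - 1"] that kn by (auto simp: \<mu>_def lam_def)

  \<comment> \<open>Mean and variance of the two-sided branches; for t > 0 they are the mean and the
    square of \<open>D\<close> for the eigenvalues themselves.\<close>
  define m where "m t = (\<Sum>j=1..k. \<mu> j t) / k" for t
  define d where "d t = (\<Sum>j=1..k. (\<mu> j t - m t)\<^sup>2) / k" for t
  have "cgerm (\<lambda>t. (\<Sum>j=1..k. complex_of_real (\<mu> j t)) / of_real k)"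
    by (intro cgerm_divide_const cgerm_sum \<mu>)
  then have m: "rgerm m" by (simp add: m_def[abs_def])
  have "cgerm (\<lambda>t. (\<Sum>j=1..k. (complex_of_real (\<mu> j t) - of_real (m t)) ^ 2) / of_real k)"
    by (intro cgerm_divide_const cgerm_sum cgerm_power cgerm_diff \<mu> m)
  then have d: "rgerm d" by (simp add: d_def[abs_def])
  have "(m \<longlongrightarrow> lam_mean k (H 0)) (at 0)"
    unfolding m_def[abs_def] lam_mean_def using assms(1) by (intro tendsto_intros \<mu>) auto
  then have d_lim: "(d \<longlongrightarrow> (\<Sum>j=1..k. (lam (H 0) j - lam_mean k (H 0))\<^sup>2) / k) (at 0)"
    unfolding d_def[abs_def] using assms(1) by (intro tendsto_intros \<mu>) auto
  have "\<forall>\<^sub>F t in at 0. d t \<ge> 0" by (simp add: d_def sum_nonneg)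
  from rgerm_sqrt_at_right[OF d this d_lim] obtain g where
    g: "rgerm g" "(g \<longlongrightarrow> D k (H 0)) (at 0)" "\<forall>\<^sub>F t in at_right 0. sqrt (d t) = g t"
    by (auto simp: D_def)
  have "\<forall>\<^sub>F t in at_right 0. \<forall>j\<in>{1..k}. lam (H t) j = \<mu> j t"
    by (intro eventually_ball_finite ballI \<mu>) simp
  then have "\<forall>\<^sub>F t in at_right 0. D k (H t) = g t"
    using g(3)
  proof eventually_elim
    case (elim t)
    have "lam_mean k (H t) = m t" using elim(1) by (simp add: lam_mean_def m_def)
    then have "D k (H t) = sqrt (d t)" using elim(1) by (simp add: D_def d_def)
    then show ?case using elim(2) by simp
  qed
  from rgerm_imp_ps_on[where g = "\<lambda>t. D k (H t)", OF g(1,2) this]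
  obtain eD aD where D: "eD > 0" "ps_on (\<lambda>t. D k (H t)) eD aD" by blast
  have "\<forall>j\<in>{1..k}. \<exists>e a. e > 0 \<and> ps_on (\<lambda>t. lam (H t) j) e a"
    using rgerm_imp_ps_on[where g = "\<lambda>t. lam (H t) j" for j, OF \<mu>] by blast
  then obtain e a where ea: "\<And>j. j \<in> {1..k} \<Longrightarrow> e j > 0" "\<And>j. j \<in> {1..k} \<Longrightarrow> ps_on (\<lambda>t. lam (H t) j) (e j) (a j)"
    by metis
  define eps where "eps = Min (insert eD (e ` {1..k}))"
  have eps: "eps > 0" "eps \<le> eD" "\<And>j. j \<in> {1..k} \<Longrightarrow> eps \<le> e j"
  proof -
    have fin: "finite (insert eD (e ` {1..k}))" by simp
    show "eps > 0" unfolding eps_def by (subst Min_gr_iff[OF fin]) (use D(1) ea(1) in auto)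
    show "eps \<le> eD" "\<And>j. j \<in> {1..k} \<Longrightarrow> eps \<le> e j" unfolding eps_def by (rule Min_le[OF fin]; simp)+
  qed
  have psD: "ps_on (\<lambda>t. D k (H t)) eps aD" using D(2) eps(2) by (rule ps_on_subset)
  have ps: "ps_on (\<lambda>t. lam (H t) j) eps (a j)" if "j \<in> {1..k}" for j
    using ea(2)[OF that] eps(3)[OF that] by (rule ps_on_subset)
  have ps_mean: "ps_on (\<lambda>t. lam_mean k (H t)) eps (\<lambda>l. (\<Sum>j=1..k. a j l) / k)"
    unfolding lam_mean_def by (intro ps_on_divide ps_on_sum ps)
  have ps_s: "\<exists>b. ps_on (\<lambda>t. lam (H t) i - lam (H t) j) eps b" if "i \<in> {1..k}" "j \<in> {1..k}" for i j
    using ps_on_diff[OF ps[OF that(1)] ps[OF that(2)]] by blast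
  have ps_m: "\<exists>b. ps_on (\<lambda>t. lam (H t) i - lam_mean k (H t)) eps b" if "i \<in> {1..k}" for i
    using ps_on_diff[OF ps[OF that] ps_mean] by blast

  define s where "s i j t = lam (H t) i - lam (H t) j" for i j t
  define sm where "sm i t = lam (H t) i - lam_mean k (H t)" for i t
  have ord_D: "enat p \<le> ord0 (\<lambda>t. D k (H t)) \<longleftrightarrow> vanishes_to_order p (\<lambda>t. D k (H t))" for p
    using eps(1) psD by (intro enat_le_ord0_iff) blast
  have ord_s: "enat p \<le> ord0 (s i j) \<longleftrightarrow> vanishes_to_order p (s i j)" if "i \<in> {1..k}" "j \<in> {1..k}" for p i j
    unfolding s_def using eps(1) ps_s[OF that] by (intro enat_le_ord0_iff) blast
  have ord_m: "enat p \<le> ord0 (sm i) \<longleftrightarrow> vanishes_to_order p (sm i)" if "i \<in> {1..k}" for p i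
    unfolding sm_def using eps(1) ps_m[OF that] by (intro enat_le_ord0_iff) blast

  have "\<forall>\<^sub>F t in at 0. t \<in> {-eps0<..<eps0}"
    by (rule eventually_at_in_open') (use assms(3) in auto)
  from at_0_imp_at_right_0[OF this]
  have sorted: "\<forall>\<^sub>F t in at_right 0. \<forall>i j. 1 \<le> i \<and> i \<le> j \<and> j \<le> k \<longrightarrow> lam (H t) i \<le> lam (H t) j"
  proof eventually_elim
    case (elim t)
    then have "H t \<in> herm n" using assms(4) by blast
    from eigs_herm(1,2)[OF this] show ?case
      using kn by (auto simp: lam_def intro!: sorted_nth_mono)
  qed

  \<comment> \<open>Vanishing to order p is passed around two cycles: from \<open>D\<close> to all
    deviations to \<open>s 1 k\<close> and back to \<open>D\<close>, and from \<open>s 1 k\<close>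
    to all gaps, in particular the adjacent ones, and back to \<open>s 1 k\<close>.\<close>
  have D_m: "vanishes_to_order p (sm i)" if "vanishes_to_order p (\<lambda>t. D k (H t))" "i \<in> {1..k}" for p i
    using that(1) by (rule vanishes_to_order_mono[where c = "sqrt k"]) (use that(2) deviation_le_D in \<open>auto simp: sm_def\<close>)
  have m_1k: "vanishes_to_order p (s 1 k)" if "\<And>i. i \<in> {1..k} \<Longrightarrow> vanishes_to_order p (sm i)" for p
  proof -
    have "vanishes_to_order p (\<lambda>t. sm 1 t - sm k t)"
      using assms(1) by (intro vanishes_to_order_diff that) auto
    then show ?thesis by (simp add: sm_def s_def[abs_def])
  qed
  have spread: "vanishes_to_order p (s i j)" if "vanishes_to_order p (s 1 k)" "1 \<le> i" "i < j" "j \<le> k" for p i j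
    using that(1)
  proof (rule vanishes_to_order_mono[where c = 1])
    show "\<forall>\<^sub>F t in at_right 0. \<bar>s i j t\<bar> \<le> 1 * \<bar>s 1 k t\<bar>"
      using sorted
    proof eventually_elim
      case (elim t)
      have "lam (H t) 1 \<le> lam (H t) i" "lam (H t) i \<le> lam (H t) j" "lam (H t) j \<le> lam (H t) k"
        using elim that by auto
      then show ?case by (simp add: s_def)
    qed
  qed simp
  have spread_D: "vanishes_to_order p (\<lambda>t. D k (H t))" if "vanishes_to_order p (s 1 k)" for p
    using that
  proof (rule vanishes_to_order_mono[where c = 1])
    show "\<forall>\<^sub>F t in at_right 0. \<bar>D k (H t)\<bar> \<le> 1 * \<bar>s 1 k t\<bar>"
      using sorted
    proof eventually_elim
      case (elim t)
      then show ?case using D_le_spread[of k "H t"] assms(1) by (simp add: s_def)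
    qed
  qed simp
  have adj: "vanishes_to_order p (s 1 k)" if "\<And>i. 1 \<le> i \<Longrightarrow> i \<le> k - 1 \<Longrightarrow> vanishes_to_order p (s i (i + 1))" for p
  proof -
    \<comment> \<open>A telescoping sum; \<open>lam\<close> is negated because each gap is the lower
      minus the higher eigenvalue.\<close>
    have "s 1 k = (\<lambda>t. \<Sum>i=1..<k. s i (i + 1) t)"
    proof
      fix t
      show "s 1 k t = (\<Sum>i=1..<k. s i (i + 1) t)"
        using sum_Suc_diff'[of 1 k "\<lambda>i. - lam (H t) i"] assms(1) by (simp add: s_def)
    qed
    moreover have "vanishes_to_order p (\<lambda>t. \<Sum>i=1..<k. s i (i + 1) t)"
      by (intro vanishes_to_order_sum that) auto
    ultimately show ?thesis by simp
  qed

  let ?S1 = "{ord0 (s i j) | i j. 1 \<le> i \<and> i < j \<and> j \<le> k}"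
  let ?S2 = "{ord0 (s i (i + 1)) | i. 1 \<le> i \<and> i \<le> k - 1}"
  let ?S3 = "{ord0 (sm i) | i. 1 \<le> i \<and> i \<le> k}"
  \<comment> \<open>Finiteness and nonemptiness are what give \<open>Min\<close> its meaning: a
    bound from below holds for \<open>Min\<close> exactly when it holds for every member.\<close>
  have fin: "finite ?S1" "finite ?S2" "finite ?S3"
  proof -
    have "?S1 \<subseteq> (\<lambda>(i, j). ord0 (s i j)) ` ({..k} \<times> {..k})" by force
    then show "finite ?S1" by (rule finite_subset) simp
    have "?S2 \<subseteq> (\<lambda>i. ord0 (s i (i + 1))) ` {..k}" by force
    then show "finite ?S2" by (rule finite_subset) simp
    have "?S3 \<subseteq> (\<lambda>i. ord0 (sm i)) ` {..k}" by force
    then show "finite ?S3" by (rule finite_subset) simp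
  qed
  have ne: "?S1 \<noteq> {}" "?S2 \<noteq> {}" "?S3 \<noteq> {}"
  proof -
    have "ord0 (s 1 2) \<in> ?S1" using assms(1) by (intro CollectI exI[of _ 1] exI[of _ 2]) auto
    then show "?S1 \<noteq> {}" by blast
    have "ord0 (s 1 (1 + 1)) \<in> ?S2" using assms(1) by (intro CollectI exI[of _ 1]) auto
    then show "?S2 \<noteq> {}" by blast
    have "ord0 (sm 1) \<in> ?S3" using assms(1) by (intro CollectI exI[of _ 1]) auto
    then show "?S3 \<noteq> {}" by blast
  qed
  have min1: "enat p \<le> Min ?S1 \<longleftrightarrow> (\<forall>i j. 1 \<le> i \<and> i < j \<and> j \<le> k \<longrightarrow> vanishes_to_order p (s i j))" for p
    unfolding Min_ge_iff[OF fin(1) ne(1)] using ord_s by fastforce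
  have min2: "enat p \<le> Min ?S2 \<longleftrightarrow> (\<forall>i. 1 \<le> i \<and> i \<le> k - 1 \<longrightarrow> vanishes_to_order p (s i (i + 1)))" for p
    unfolding Min_ge_iff[OF fin(2) ne(2)] using ord_s by fastforce
  have min3: "enat p \<le> Min ?S3 \<longleftrightarrow> (\<forall>i. 1 \<le> i \<and> i \<le> k \<longrightarrow> vanishes_to_order p (sm i))" for p
    unfolding Min_ge_iff[OF fin(3) ne(3)] using ord_m by fastforce
  have one: "enat p \<le> ord0 (s 1 k) \<longleftrightarrow> vanishes_to_order p (s 1 k)" for p
    using assms(1) by (intro ord_s) auto
  have e1: "Min ?S1 = ord0 (s 1 k)"
  proof (rule enat_eqI_le)
    fix p show "enat p \<le> Min ?S1 \<longleftrightarrow> enat p \<le> ord0 (s 1 k)"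
      unfolding min1 one using spread[of p] assms(1) by auto
  qed
  have e2: "Min ?S2 = ord0 (s 1 k)"
  proof (rule enat_eqI_le)
    fix p show "enat p \<le> Min ?S2 \<longleftrightarrow> enat p \<le> ord0 (s 1 k)"
      unfolding min2 one
    proof
      assume "\<forall>i. 1 \<le> i \<and> i \<le> k - 1 \<longrightarrow> vanishes_to_order p (s i (i + 1))"
      then show "vanishes_to_order p (s 1 k)" by (intro adj) blast
    next
      assume "vanishes_to_order p (s 1 k)"
      from spread[OF this] assms(1) show "\<forall>i. 1 \<le> i \<and> i \<le> k - 1 \<longrightarrow> vanishes_to_order p (s i (i + 1))"
        by auto
    qed
  qed
  have e3: "Min ?S3 = ord0 (s 1 k)"
  proof (rule enat_eqI_le)
    fix p show "enat p \<le> Min ?S3 \<longleftrightarrow> enat p \<le> ord0 (s 1 k)"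
      unfolding min3 one using D_m[of p] m_1k[of p] spread_D[of p] by auto
  qed
  have e4: "ord0 (\<lambda>t. D k (H t)) = ord0 (s 1 k)"
  proof (rule enat_eqI_le)
    fix p show "enat p \<le> ord0 (\<lambda>t. D k (H t)) \<longleftrightarrow> enat p \<le> ord0 (s 1 k)"
      unfolding ord_D one using D_m[of p] m_1k[of p] spread_D[of p] by auto
  qed
  have "ord0 (\<lambda>t. D k (H t)) = Min ?S1" "Min ?S1 = Min ?S2" "Min ?S2 = ord0 (s 1 k)" "ord0 (s 1 k) = Min ?S3"
    using e1 e2 e3 e4 by simp_all
  moreover have "\<forall>i j. 1 \<le> i \<and> i < j \<and> j \<le> k \<longrightarrow> (\<exists>a. ps_on (\<lambda>t. lam (H t) i - lam (H t) j) eps a)"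
    using ps_s by auto
  moreover have "\<forall>i. 1 \<le> i \<and> i \<le> k \<longrightarrow> (\<exists>a. ps_on (\<lambda>t. lam (H t) i - lam_mean k (H t)) eps a)"
    using ps_m by auto
  ultimately show ?thesis
    unfolding s_def[abs_def] sm_def[abs_def]
    using eps(1) psD by (intro exI[of _ eps] conjI exI[of _ aD])
qed

end
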